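(* Let $d\in\mathbb N$, $0<p,\theta\le\infty$ and $\alpha>1/p$. Then there is a constant $c>0$, independent of $n$, such that for all $n\in\mathbb N$, $$\operatorname{Int}_n(U^\alpha_{p,\theta}(\mathbb T^d))\ge c\,n^{-\alpha}(\log n)^{(d-1)(1-1/\theta)_+}.$$
   Context: Conventions: $1/\infty=0$, $0^0=1$, $a_+=\max\{a,0\}$, $[d]=\{1,\dots,d\}$. Optimal cubature error: for a class $F$ of functions on $\mathbb T^d$, $$\operatorname{Int}_n(F)=\inf_{x^1,\dots,x^n\in[0,1]^d,\ \lambda_1,\dots,\lambda_n\in\mathbb R}\ \sup_{f\in F}\Big|\int_{[0,1]^d}f(x)\,dx-\sum_{j=1}^n\lambda_jf(x^j)\Big|.$$ Besov spaces of mixed smoothness on the torus: $\mathbb T^d$ is $[0,1]^d$ with opposite faces identified; functions on $\mathbb T^d$ are identified with functions on $\mathbb R^d$ that are $1$-periodic in each variable. Fix an integer $\ell>\alpha$. For univariate periodic $f$ and $h\in\mathbb R$, $\Delta_h^\ell(f,x)=\sum_{j=0}^{\ell}(-1)^{\ell-j}\binom{\ell}{j}f(x+jh)$. For $e\subset[d]$ and $h\in\mathbb R^d$, $\Delta_h^{\ell,e}=\prod_{i\in e}\Delta^\ell_{h_i}$, where $\Delta^\ell_{h_i}$ acts in the variable $x_i$ with the other variables fixed, and $\Delta_h^{\ell,\emptyset}=\mathrm{Id}$. For $t\in[0,1]^d$, $\omega_\ell^e(f,t)_p=\sup_{|h_i|<t_i,\,i\in e}\|\Delta_h^{\ell,e}(f)\|_{L_p(\mathbb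 T^d)}$. Define $$|f|_{B^{\alpha,e}_{p,\theta}}=\Big(\int_{[0,1]^d}\Big[\prod_{i\in e}t_i^{-\alpha}\,\omega_\ell^e(f,t)_p\Big]^\theta\prod_{i\in e}t_i^{-1}\,dt\Big)^{1/\theta}\quad(\theta<\infty),$$ and $|f|_{B^{\alpha,e}_{p,\theta}}=\sup_{t}\prod_{i\in e}t_i^{-\alpha}\omega^e_\ell(f,t)_p$ if $\theta=\infty$; for $e=\emptyset$ this is $\|f\|_p$. Then $B^\alpha_{p,\theta}(\mathbb T^d)$ is the set of $f\in L_p(\mathbb T^d)$ with $\|f\|_{B^\alpha_{p,\theta}(\mathbb T^d)}=\sum_{e\subset[d]}|f|_{B^{\alpha,e}_{p,\theta}}<\infty$ (different choices of $\ell>\alpha$ give equivalent quasi-norms), and $U^\alpha_{p,\theta}(\mathbb T^d)$ is its unit ball. Since $\alpha>1/p$, every element has a continuous representative, which is used for point evaluations. *)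

theory Defs
  imports "HOL-Analysis.Analysis" "HOL-Probability.Essential_Supremum"
begin

text \<open>
  Functions on the torus are functions on \<^typ>\<open>real ^ 'd\<close> that are 1-periodic in each variable; the
  index set $[d]$ is \<^term>\<open>UNIV :: 'd set\<close>, and \<^term>\<open>cbox 0 1 :: (real ^ 'd) set\<close> is $[0,1]^d$.
  The parameters $p, \theta \in (0,\infty]$ have type \<^typ>\<open>ennreal\<close>, where \<^term>\<open>1 / top = (0::ennreal)\<close>.
\<close>

text \<open>Power with the convention $0^0 = 1$ (for \<^term>\<open>(powr)\<close> the value is 0).\<close>

definition powr_conv :: "real \<Rightarrow> real \<Rightarrow> real" where
  "powr_conv a r = (if a = 0 \<and> r = 0 then 1 else a powr r)"

text \<open>Only used for exponents \<^term>\<open>r > (0::real)\<close>.\<close>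

definition ennreal_powr :: "ennreal \<Rightarrow> real \<Rightarrow> ennreal" where
  "ennreal_powr x r = (if x = top then top else ennreal (enn2real x powr r))"

definition periodic1 :: "(real ^ 'd \<Rightarrow> real) \<Rightarrow> bool" where
  "periodic1 f \<longleftrightarrow> (\<forall>x i. f (x + axis i 1) = f x)"

definition Lp_norm :: "ennreal \<Rightarrow> (real ^ 'd \<Rightarrow> real) \<Rightarrow> ennreal" where
  "Lp_norm p f =
     (if p = top then esssup (restrict_space lborel (cbox 0 1)) (\<lambda>x. ennreal \<bar>f x\<bar>)
      else ennreal_powr (\<integral>\<^sup>+x\<in>cbox 0 1. ennreal (\<bar>f x\<bar> powr enn2real p) \<partial>lborel) (1 / enn2real p))"

text \<open>The univariate difference $\Delta_s^\ell$ acting in the variable $x_i$.\<close>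

definition partial_diff :: "nat \<Rightarrow> 'd \<Rightarrow> real \<Rightarrow> (real ^ 'd \<Rightarrow> real) \<Rightarrow> real ^ 'd \<Rightarrow> real" where
  "partial_diff l i s f =
     (\<lambda>x. \<Sum>j\<le>l. (-1) ^ (l - j) * real (l choose j) * f (x + (real j * s) *\<^sub>R axis i 1))"

text \<open>The operator product $\prod_{i \in e} \Delta^\ell_{h_i}$; the factors commute, so the order in
  which they are composed is immaterial.\<close>

definition mixed_diff :: "nat \<Rightarrow> 'd set \<Rightarrow> real ^ 'd \<Rightarrow> (real ^ 'd \<Rightarrow> real) \<Rightarrow> real ^ 'd \<Rightarrow> real" where
  "mixed_diff l e h f = Finite_Set.fold (\<lambda>i. partial_diff l i (h $ i)) f e"

lemma partial_diff_commute:
  "partial_diff l i s (partial_diff l k r f) = partial_diff l k r (partial_diff l i s f)"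
  unfolding partial_diff_def sum_distrib_left
  by (rule ext, subst sum.swap, intro sum.cong refl) (simp add: algebra_simps)

lemma comp_fun_commute_partial_diff: "comp_fun_commute (\<lambda>i. partial_diff l i (h $ i))"
  by unfold_locales (auto simp: fun_eq_iff partial_diff_commute)

lemma mixed_diff_empty: "mixed_diff l {} h f = f"
  by (simp add: mixed_diff_def)

lemma mixed_diff_insert:
  fixes e :: "'d::finite set"
  assumes "i \<notin> e"
  shows "mixed_diff l (insert i e) h f = partial_diff l i (h $ i) (mixed_diff l e h f)"
proof -
  interpret comp_fun_commute "\<lambda>i. partial_diff l i (h $ i)"
    by (rule comp_fun_commute_partial_diff)
  show ?thesis
    unfolding mixed_diff_def using assms by simp
qed

definition mixed_modulus ::
    "ennreal \<Rightarrow> nat \<Rightarrow> 'd set \<Rightarrow> (real ^ 'd \<Rightarrow> real) \<Rightarrow> real ^ 'd \<Rightarrow> ennreal" where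
  "mixed_modulus p l e f t =
     (SUP h\<in>{h. \<forall>i\<in>e. \<bar>h $ i\<bar> < t $ i}. Lp_norm p (mixed_diff l e h f))"

text \<open>Points \<^term>\<open>t\<close> with a vanishing coordinate in \<^term>\<open>e\<close> do not contribute: there the modulus is a
  supremum over the empty set, hence 0, and also \<^term>\<open>0 powr (-\<alpha>) = (0::real)\<close>.\<close>

definition besov_seminorm ::
    "ennreal \<Rightarrow> ennreal \<Rightarrow> real \<Rightarrow> nat \<Rightarrow> 'd set \<Rightarrow> (real ^ 'd \<Rightarrow> real) \<Rightarrow> ennreal" where
  "besov_seminorm p \<theta> \<alpha> l e f =
     (if e = {} then Lp_norm p f
      else if \<theta> = top then
        (SUP t\<in>cbox 0 1. ennreal (\<Prod>i\<in>e. (t $ i) powr (-\<alpha>)) * mixed_modulus p l e f t)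
      else ennreal_powr
        (\<integral>\<^sup>+t\<in>cbox 0 1.
            ennreal_powr (ennreal (\<Prod>i\<in>e. (t $ i) powr (-\<alpha>)) * mixed_modulus p l e f t) (enn2real \<theta>)
            * ennreal (\<Prod>i\<in>e. inverse (t $ i)) \<partial>lborel)
        (1 / enn2real \<theta>))"

definition besov_norm ::
    "ennreal \<Rightarrow> ennreal \<Rightarrow> real \<Rightarrow> nat \<Rightarrow> (real ^ 'd \<Rightarrow> real) \<Rightarrow> ennreal" where
  "besov_norm p \<theta> \<alpha> l f = (\<Sum>e\<in>UNIV. besov_seminorm p \<theta> \<alpha> l e f)"

definition besov_space ::
    "ennreal \<Rightarrow> ennreal \<Rightarrow> real \<Rightarrow> nat \<Rightarrow> (real ^ 'd \<Rightarrow> real) set" where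
  "besov_space p \<theta> \<alpha> l =
     {f \<in> borel_measurable borel. periodic1 f \<and> Lp_norm p f < top \<and> besov_norm p \<theta> \<alpha> l f < top}"

definition besov_ball ::
    "ennreal \<Rightarrow> ennreal \<Rightarrow> real \<Rightarrow> nat \<Rightarrow> (real ^ 'd \<Rightarrow> real) set" where
  "besov_ball p \<theta> \<alpha> l = {f \<in> besov_space p \<theta> \<alpha> l. besov_norm p \<theta> \<alpha> l f \<le> 1}"

text \<open>Elements of $L_p$ are classes modulo null sets; point evaluations refer to the continuous
  representative of a class.\<close>

definition continuous_reps :: "(real ^ 'd \<Rightarrow> real) set \<Rightarrow> (real ^ 'd \<Rightarrow> real) set" where
  "continuous_reps F = {g. continuous_on UNIV g \<and> (\<exists>f\<in>F. AE x in lborel. f x = g x)}"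

text \<open>The nodes and weights are indexed by $0, \dots, n-1$.\<close>

definition cubature_error :: "nat \<Rightarrow> (real ^ 'd \<Rightarrow> real) set \<Rightarrow> ennreal" where
  "cubature_error n F =
     (INF (x, w) \<in> {(x :: nat \<Rightarrow> real ^ 'd, w :: nat \<Rightarrow> real). \<forall>j<n. x j \<in> cbox 0 1}.
        SUP f\<in>F. ennreal \<bar>(LINT y:cbox 0 1|lborel. f y) - (\<Sum>j<n. w j * f (x j))\<bar>)"

end

theory Submission
  imports Defs
begin

text \<open>
  Given nodes $x^1, \dots, x^n$, choose $m$ with $2^m \ge 2n$ and, for a multi-index $k$ with
  $|k|_1 = m$, let $f_k$ be the sum of tensor product bumps over those of the $2^m$ dyadic boxes
  of side lengths $2^{-k_i}$ that contain no node; there are at least $2^{m-1}$ of them.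
  Every quadrature rule vanishes on the nonnegative function $f = A \sum_{k \in K} f_k$, whose
  integral is of order $A\,|K|$. Bumps of one level have disjoint supports, so the sup norm of
  the mixed difference of $f_k$ in the directions $e$ is at most a constant times
  $\prod_{i \in e} \min(1, 2^{k_i} |h_i|)^\ell$, and on the torus sup norm bounds suffice for
  every $p$. With $t$ scaled by $t_i^{-\alpha}$ the product is
  $2^{\alpha m} \prod_i \beta(2^{k_i} t_i)$ for a function $\beta$ decaying geometrically in both
  directions ($t_i = 1$ for $i \notin e$); its sum over $k$ is therefore bounded in $t$, and its
  integral against $\prod_i dt_i / t_i$ is bounded for each $k$. Estimating
  $(\sum_k a_k)^\theta$ by $(\sup \sum_k a_k)^{\theta - 1} \sum_k a_k$ shows that
  $A \sim 2^{-\alpha m} |K|^{-1/\theta}$ keeps $f$ in the unit ball. For $\theta > 1$ one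
  takes $|K| \sim m^{d-1}$, for $\theta \le 1$ a single level.
\<close>

subsection \<open>Differences of periodic bumps\<close>

definition fdiff :: "nat \<Rightarrow> real \<Rightarrow> (real \<Rightarrow> real) \<Rightarrow> real \<Rightarrow> real" where
  "fdiff l s g x = (\<Sum>j\<le>l. (-1) ^ (l - j) * real (l choose j) * g (x + real j * s))"

text \<open>Pascal's rule splits each coefficient into two. Reading a difference of order l + 1 as
  an increment of one of order l allows induction on l with a mean value estimate.\<close>

lemma fdiff_Suc: "fdiff (Suc l) s g x = fdiff l s g (x + s) - fdiff l s g x"
proof -
  \<comment> \<open>At j = l truncated subtraction makes both exponents 0, so the sign does not
    flip; the identity survives because \<open>l choose Suc l\<close> is 0.\<close>
  have sgn: "(-1) ^ (l - j) * real (l choose Suc j) = - ((-1) ^ (l - Suc j) * real (l choose Suc j))" for j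
  proof (cases "j < l")
    case True
    then have "l - j = Suc (l - Suc j)" by simp
    then show ?thesis by simp
  qed (simp add: binomial_eq_0)
  have a: "fdiff l s g x = (\<Sum>j\<le>Suc l. (-1) ^ (l - j) * real (l choose j) * g (x + real j * s))"
    by (simp add: fdiff_def)
  also have "\<dots> = (-1) ^ l * g x
      + (\<Sum>j\<le>l. (-1) ^ (l - Suc j) * real (l choose Suc j) * g (x + real (Suc j) * s))"
    by (subst sum.atMost_Suc_shift) simp
  finally have a: "fdiff l s g x = (-1) ^ l * g x
      + (\<Sum>j\<le>l. (-1) ^ (l - Suc j) * real (l choose Suc j) * g (x + real (Suc j) * s))" .
  have "fdiff (Suc l) s g x = - ((-1) ^ l * g x)
      + (\<Sum>j\<le>l. (-1) ^ (l - j) * real (Suc l choose Suc j) * g (x + real (Suc j) * s))"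
    unfolding fdiff_def by (subst sum.atMost_Suc_shift) simp
  also have "(\<Sum>j\<le>l. (-1) ^ (l - j) * real (Suc l choose Suc j) * g (x + real (Suc j) * s))
      = (\<Sum>j\<le>l. (-1) ^ (l - j) * real (l choose j) * g (x + s + real j * s)
          - (-1) ^ (l - Suc j) * real (l choose Suc j) * g (x + real (Suc j) * s))"
  proof (intro sum.cong refl)
    fix j
    have "(-1) ^ (l - j) * real (Suc l choose Suc j) * g (x + real (Suc j) * s)
        = (-1) ^ (l - j) * real (l choose j) * g (x + real (Suc j) * s)
          + (-1) ^ (l - j) * real (l choose Suc j) * g (x + real (Suc j) * s)"
      by (simp add: ring_distribs)
    also have "\<dots> = (-1) ^ (l - j) * real (l choose j) * g (x + s + real j * s)
          - (-1) ^ (l - Suc j) * real (l choose Suc j) * g (x + real (Suc j) * s)"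
      unfolding sgn by (simp add: algebra_simps)
    finally show "(-1) ^ (l - j) * real (Suc l choose Suc j) * g (x + real (Suc j) * s)
        = (-1) ^ (l - j) * real (l choose j) * g (x + s + real j * s)
          - (-1) ^ (l - Suc j) * real (l choose Suc j) * g (x + real (Suc j) * s)" .
  qed
  also have "- ((-1) ^ l * g x) + \<dots> = fdiff l s g (x + s) - fdiff l s g x"
    by (subst a) (simp add: sum_subtractf fdiff_def)
  finally show ?thesis .
qed

lemma abs_fdiff_le_sup:
  assumes "\<And>x. \<bar>g x\<bar> \<le> M"
  shows "\<bar>fdiff l s g x\<bar> \<le> 2 ^ l * M"
proof -
  have "\<bar>fdiff l s g x\<bar> \<le> (\<Sum>j\<le>l. \<bar>(-1) ^ (l - j) * real (l choose j) * g (x + real j * s)\<bar>)"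
    unfolding fdiff_def by (rule sum_abs)
  also have "\<dots> \<le> (\<Sum>j\<le>l. real (l choose j) * M)"
    by (intro sum_mono) (simp add: abs_mult assms mult_left_mono)
  also have "\<dots> = real (\<Sum>j\<le>l. l choose j) * M"
    by (simp add: sum_distrib_right)
  finally show ?thesis by (simp add: choose_row_sum)
qed

lemma fdiff_scale: "fdiff l s (\<lambda>x. g (c * x)) x = fdiff l (c * s) g (c * x)"
  by (simp add: fdiff_def algebra_simps)

text \<open>Only the derivative of order l is bounded, the lower ones merely have to exist. The
  derivative is an existential witness at each order, which suits inductive closure proofs.\<close>

primrec deriv_bounded :: "nat \<Rightarrow> real \<Rightarrow> (real \<Rightarrow> real) \<Rightarrow> bool" where
  "deriv_bounded 0 M g \<longleftrightarrow> (\<forall>x. \<bar>g x\<bar> \<le> M)"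
| "deriv_bounded (Suc l) M g \<longleftrightarrow>
     (\<exists>g'. (\<forall>x. (g has_real_derivative g' x) (at x)) \<and> deriv_bounded l M g')"

lemma deriv_bounded_add:
  "deriv_bounded l M f \<Longrightarrow> deriv_bounded l N g \<Longrightarrow> deriv_bounded l (M + N) (\<lambda>x. f x + g x)"
proof (induction l arbitrary: f g)
  case 0
  then show ?case by (auto intro: order_trans[OF abs_triangle_ineq] add_mono)
next
  case (Suc l)
  then obtain f' g' where "\<forall>x. (f has_real_derivative f' x) (at x)" "deriv_bounded l M f'"
    "\<forall>x. (g has_real_derivative g' x) (at x)" "deriv_bounded l N g'" by auto
  with Suc.IH[of f' g'] show ?case
    by (auto intro!: exI[of _ "\<lambda>x. f' x + g' x"] DERIV_add)
qed

lemma deriv_bounded_cmult: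
  "deriv_bounded l M f \<Longrightarrow> deriv_bounded l (\<bar>c\<bar> * M) (\<lambda>x. c * f x)"
proof (induction l arbitrary: f)
  case 0
  then show ?case by (auto simp: abs_mult intro: mult_left_mono)
next
  case (Suc l)
  then obtain f' where "\<forall>x. (f has_real_derivative f' x) (at x)" "deriv_bounded l M f'" by auto
  with Suc.IH[of f'] show ?case
    by (auto intro!: exI[of _ "\<lambda>x. c * f' x"] DERIV_cmult)
qed

text \<open>By \<open>fdiff_Suc\<close> each order adds one increment over a step s. Differences
  commute with differentiation, so the mean value inequality pays a factor
  \<open>\<bar>s\<bar>\<close> for one derivative.\<close>

lemma abs_fdiff_le_deriv:
  "deriv_bounded l M g \<Longrightarrow> \<bar>fdiff l s g x\<bar> \<le> M * \<bar>s\<bar> ^ l"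
proof (induction l arbitrary: g x)
  case 0
  then show ?case by (simp add: fdiff_def)
next
  case (Suc l)
  then obtain g' where g': "\<And>x. (g has_real_derivative g' x) (at x)" and b: "deriv_bounded l M g'"
    by auto
  have sh: "((\<lambda>x. g (x + c)) has_real_derivative g' (y + c)) (at y)" for c y
    by (rule DERIV_shift[THEN iffD1]) (rule g')
  have D: "((\<lambda>y. fdiff l s g y) has_real_derivative fdiff l s g' y) (at y within UNIV)" for y
    unfolding fdiff_def
    by (intro DERIV_sum DERIV_cmult) (rule sh)
  have "norm (fdiff l s g (x + s) - fdiff l s g x) \<le> (M * \<bar>s\<bar> ^ l) * norm (x + s - x)"
    by (rule field_differentiable_bound[OF convex_UNIV D]) (use Suc.IH[OF b] in auto)
  then show ?case by (simp add: fdiff_Suc algebra_simps)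
qed

section \<open>Sine powers weighted on unit cells\<close>

text \<open>The cosine power makes the family closed, up to linear combinations, under
  differentiation. The weight w is kept general so that one bound serves every selection of
  cells.\<close>

definition trig_cell :: "(int \<Rightarrow> real) \<Rightarrow> nat \<Rightarrow> nat \<Rightarrow> real \<Rightarrow> real" where
  "trig_cell w a b u = w \<lfloor>u\<rfloor> * sin (pi * u) ^ a * cos (pi * u) ^ b"

lemma abs_trig_cell_le:
  assumes "\<And>z. \<bar>w z\<bar> \<le> 1"
  shows "\<bar>trig_cell w a b u\<bar> \<le> \<bar>sin (pi * u)\<bar> ^ a"
proof -
  have "\<bar>w \<lfloor>u\<rfloor>\<bar> * \<bar>sin (pi * u)\<bar> ^ a * \<bar>cos (pi * u)\<bar> ^ b \<le> 1 * \<bar>sin (pi * u)\<bar> ^ a * 1"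
    by (intro mult_mono assms) (auto simp: power_le_one)
  then show ?thesis by (simp add: trig_cell_def abs_mult power_abs)
qed

lemma sin_pi_of_int: "sin (pi * real_of_int z) = 0"
  using sin_integer_2pi sin_zero_iff_int2 by (auto simp: mult.commute)

text \<open>At the integers the jump of the factor \<^term>\<open>w \<lfloor>u\<rfloor>\<close> is absorbed by a double zero of the sine power.\<close>

lemma DERIV_trig_cell:
  assumes w: "\<And>z. \<bar>w z\<bar> \<le> 1" and a: "1 \<le> a"
  shows "(trig_cell w (Suc a) b has_real_derivative
    pi * (real (Suc a) * trig_cell w a (Suc b) u - real b * trig_cell w (Suc (Suc a)) (b - 1) u)) (at u)"
proof (cases "u \<in> \<int>")
  case False
  define c where "c = w \<lfloor>u\<rfloor>"
  have ev: "eventually (\<lambda>y. \<lfloor>y\<rfloor> = \<lfloor>u\<rfloor>) (nhds u)"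
  proof -
    have "u \<in> {of_int \<lfloor>u\<rfloor><..<of_int \<lfloor>u\<rfloor> + 1}"
    proof -
      have "of_int \<lfloor>u\<rfloor> \<noteq> u" using False Ints_of_int by metis
      moreover have "of_int \<lfloor>u\<rfloor> \<le> u" "u < of_int \<lfloor>u\<rfloor> + 1" using floor_correct[of u] by auto
      ultimately show ?thesis unfolding greaterThanLessThan_iff by linarith
    qed
    then have "eventually (\<lambda>y. y \<in> {of_int \<lfloor>u\<rfloor><..<of_int \<lfloor>u\<rfloor> + 1}) (nhds u)"
      by (intro eventually_nhds_in_open) auto
    then show ?thesis by eventually_elim (simp add: floor_unique)
  qed
  have "((\<lambda>y. c * sin (pi * y) ^ Suc a * cos (pi * y) ^ b) has_real_derivative
    pi * (real (Suc a) * trig_cell w a (Suc b) u - real b * trig_cell w (Suc (Suc a)) (b - 1) u)) (at u)"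
  proof -
    have s: "((\<lambda>y. sin (pi * y)) has_real_derivative pi * cos (pi * u)) (at u)"
      by (auto intro!: derivative_eq_intros)
    have c: "((\<lambda>y. cos (pi * y)) has_real_derivative - (pi * sin (pi * u))) (at u)"
      by (auto intro!: derivative_eq_intros)
    \<comment> \<open>For b = 0 the truncated exponent \<open>b - 1\<close> does no harm, since its
      coefficient is 0.\<close>
    show ?thesis
      by (rule DERIV_cong[OF DERIV_mult[OF DERIV_cmult[OF DERIV_power_Suc[OF s]] DERIV_power[OF c]]])
        (cases b; simp add: trig_cell_def c_def algebra_simps)
  qed
  moreover have "eventually (\<lambda>y. c * sin (pi * y) ^ Suc a * cos (pi * y) ^ b = trig_cell w (Suc a) b y) (nhds u)"
    using ev by eventually_elim (simp add: trig_cell_def c_def)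
  ultimately show ?thesis
    by (subst (asm) DERIV_cong_ev) auto
next
  case True
  then obtain z where z: "u = real_of_int z" by (auto elim: Ints_cases)
  have s0: "sin (pi * u) = 0" unfolding z by (rule sin_pi_of_int)
  have zero: "trig_cell w (Suc c) b u = 0" for c b
    by (simp add: trig_cell_def s0)
  have bd: "\<bar>trig_cell w (Suc a) b y\<bar> \<le> (pi * \<bar>y - u\<bar>)\<^sup>2" for y
  proof -
    have "sin (pi * y) = sin (pi * (y - u)) * cos (pi * u)"
      using s0 sin_add[of "pi * (y - u)" "pi * u"] by (simp add: algebra_simps)
    then have "\<bar>sin (pi * y)\<bar> \<le> \<bar>sin (pi * (y - u))\<bar>"
      by (simp add: abs_mult mult_left_le)
    also have "\<dots> \<le> pi * \<bar>y - u\<bar>"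
      using abs_sin_x_le_abs_x[of "pi * (y - u)"] by (simp add: abs_mult)
    finally have *: "\<bar>sin (pi * y)\<bar> \<le> pi * \<bar>y - u\<bar>" .
    have "\<bar>trig_cell w (Suc a) b y\<bar> \<le> \<bar>sin (pi * y)\<bar> ^ Suc a"
      by (rule abs_trig_cell_le[OF w])
    also have "\<dots> \<le> \<bar>sin (pi * y)\<bar> ^ 2"
      using a by (intro power_decreasing) auto
    also have "\<dots> \<le> (pi * \<bar>y - u\<bar>)\<^sup>2"
      using * by (intro power_mono) auto
    finally show ?thesis .
  qed
  have "(trig_cell w (Suc a) b has_real_derivative 0) (at u)"
    unfolding DERIV_def
  proof (rule Lim_null_comparison)
    show "\<forall>\<^sub>F h in at 0. norm ((trig_cell w (Suc a) b (u + h) - trig_cell w (Suc a) b u) / h) \<le> pi\<^sup>2 * \<bar>h\<bar>"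
    proof (rule eventually_at_filter[THEN iffD2], rule always_eventually, intro allI impI)
      fix h :: real assume h: "h \<noteq> 0"
      have "\<bar>trig_cell w (Suc a) b (u + h)\<bar> \<le> (pi * \<bar>h\<bar>)\<^sup>2" using bd[of "u + h"] by simp
      also have "\<dots> = pi\<^sup>2 * \<bar>h\<bar> * \<bar>h\<bar>" by (simp add: power2_eq_square)
      finally show "norm ((trig_cell w (Suc a) b (u + h) - trig_cell w (Suc a) b u) / h) \<le> pi\<^sup>2 * \<bar>h\<bar>"
        using h by (simp add: zero divide_le_eq)
    qed
    show "((\<lambda>h. pi\<^sup>2 * \<bar>h\<bar>) \<longlongrightarrow> 0) (at 0)" by (auto intro!: tendsto_eq_intros)
  qed
  \<comment> \<open>Since a is positive, both terms of the claimed derivative contain a sine factor,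
    so the claimed value is 0 as well.\<close>
  moreover obtain a' where "a = Suc a'" using a by (cases a) auto
  ultimately show ?thesis by (simp add: zero)
qed

text \<open>A derivative lowers the sine exponent by at most one, so l of them can be taken while
  the exponent stays large enough for \<open>DERIV_trig_cell\<close>. M precedes w, which later
  gives a constant common to all levels and cells.\<close>

lemma deriv_bounded_trig_cell:
  "Suc l \<le> a \<Longrightarrow> \<exists>M. \<forall>w. (\<forall>z. \<bar>w z\<bar> \<le> 1) \<longrightarrow> deriv_bounded l M (trig_cell w a b)"
proof (induction l arbitrary: a b)
  case 0
  have "\<bar>trig_cell w a b x\<bar> \<le> 1" if "\<forall>z. \<bar>w z\<bar> \<le> 1" for w x
    using abs_trig_cell_le[of w a b x] that power_le_one[of "\<bar>sin (pi * x)\<bar>" a]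
    by (force intro: order_trans)
  then show ?case by auto
next
  case (Suc l)
  then obtain a' where a': "a = Suc a'" "1 \<le> a'" "Suc l \<le> a'" by (cases a) auto
  obtain M where M: "\<And>w. \<forall>z. \<bar>w z\<bar> \<le> 1 \<Longrightarrow> deriv_bounded l M (trig_cell w a' (Suc b))"
    using Suc.IH[of a' "Suc b"] a' by auto
  obtain N where N: "\<And>w. \<forall>z. \<bar>w z\<bar> \<le> 1 \<Longrightarrow> deriv_bounded l N (trig_cell w (Suc (Suc a')) (b - 1))"
    using Suc.IH[of "Suc (Suc a')" "b - 1"] a' by auto
  define L where "L = \<bar>pi * real (Suc a')\<bar> * M + \<bar>- (pi * real b)\<bar> * N"
  have "deriv_bounded (Suc l) L (trig_cell w a b)" if w: "\<forall>z. \<bar>w z\<bar> \<le> 1" for w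
  proof -
    have "deriv_bounded l L (\<lambda>u. pi * real (Suc a') * trig_cell w a' (Suc b) u
        + - (pi * real b) * trig_cell w (Suc (Suc a')) (b - 1) u)"
      unfolding L_def by (intro deriv_bounded_add deriv_bounded_cmult M N w)
    then have "deriv_bounded l L (\<lambda>u. pi * (real (Suc a') * trig_cell w a' (Suc b) u
        - real b * trig_cell w (Suc (Suc a')) (b - 1) u))"
      by (rule back_subst[of "deriv_bounded l L"]) (simp add: fun_eq_iff algebra_simps)
    moreover have "(trig_cell w a b has_real_derivative
        pi * (real (Suc a') * trig_cell w a' (Suc b) u - real b * trig_cell w (Suc (Suc a')) (b - 1) u)) (at u)" for u
      unfolding a'(1) by (rule DERIV_trig_cell) (use w a' in auto)
    ultimately show ?thesis unfolding deriv_bounded.simps(2)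
      by (intro exI[of _ "\<lambda>u. pi * (real (Suc a') * trig_cell w a' (Suc b) u
        - real b * trig_cell w (Suc (Suc a')) (b - 1) u)"] conjI allI)
  qed
  then show ?case by blast
qed

section \<open>Periodic dyadic bumps and their differences\<close>

definition cell :: "nat \<Rightarrow> real \<Rightarrow> int" where
  "cell k x = \<lfloor>2 ^ k * x\<rfloor> mod 2 ^ k"

text \<open>The exponent is even, which gives nonnegativity and also periodicity at level 0, where a
  shift by 1 flips the sign of the sine. It exceeds l, so the derivative of order l is
  bounded.\<close>

definition bump :: "nat \<Rightarrow> nat \<Rightarrow> int \<Rightarrow> real \<Rightarrow> real" where
  "bump l k j x = of_bool (cell k x = j) * sin (pi * (2 ^ k * x)) ^ (2 * l + 2)"

lemma bump_eq_trig_cell: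
  "bump l k j = (\<lambda>x. trig_cell (\<lambda>z. of_bool (z mod 2 ^ k = j)) (2 * l + 2) 0 (2 ^ k * x))"
  by (simp add: bump_def trig_cell_def cell_def fun_eq_iff)

lemma bump_nonneg: "0 \<le> bump l k j x"
proof -
  have "0 \<le> sin (pi * (2 ^ k * x)) ^ (2 * l + 2)" by (rule zero_le_even_power) simp
  then show ?thesis by (simp add: bump_def)
qed

lemma bump_le_1: "bump l k j x \<le> 1"
proof -
  have "\<bar>sin (pi * (2 ^ k * x)) ^ (2 * l + 2)\<bar> \<le> 1"
    unfolding power_abs by (rule power_le_one) auto
  then show ?thesis by (auto simp: bump_def)
qed

lemma bump_eq_0: "cell k x \<noteq> j \<Longrightarrow> bump l k j x = 0"
  by (simp add: bump_def)

lemma cell_in: "cell k x \<in> {0..<2 ^ k}"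
  by (simp add: cell_def)

lemma bump_periodic: "bump l k j (x + 1) = bump l k j x"
proof -
  have "cell k (x + 1) = cell k x"
  proof -
    have "2 ^ k * (x + 1) = 2 ^ k * x + real_of_int (2 ^ k)" by (simp add: algebra_simps)
    then show ?thesis unfolding cell_def by (simp only: floor_add_int) simp
  qed
  moreover have "sin (pi * (2 ^ k * (x + 1))) ^ (2 * l + 2) = sin (pi * (2 ^ k * x)) ^ (2 * l + 2)"
  proof -
    have "sin (pi * (2 ^ k * (x + 1))) = sin (pi * (2 ^ k * x) + pi * real (2 ^ k))"
      by (simp add: algebra_simps)
    also have "\<dots> = sin (pi * (2 ^ k * x)) * cos (real (2 ^ k) * pi)"
      unfolding sin_add using sin_npi2[of "2 ^ k"] by (simp add: mult.commute)
    finally have "sin (pi * (2 ^ k * (x + 1))) = sin (pi * (2 ^ k * x)) * (-1) ^ (2 ^ k)"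
      by (simp only: cos_npi)
    then have "sin (pi * (2 ^ k * (x + 1))) ^ (2 * l + 2)
      = sin (pi * (2 ^ k * x)) ^ (2 * l + 2) * (((-1) ^ (2 ^ k)) ^ 2) ^ (l + 1)"
      by (simp add: power_mult_distrib flip: power_mult)
    then show ?thesis by (simp flip: power_mult)
  qed
  ultimately show ?thesis by (simp add: bump_def)
qed

lemma continuous_bump: "continuous_on UNIV (bump l k j)"
proof -
  have "(trig_cell (\<lambda>z. of_bool (z mod 2 ^ k = j)) (2 * l + 2) 0 has_real_derivative
     pi * (real (2 * l + 2) * trig_cell (\<lambda>z. of_bool (z mod 2 ^ k = j)) (2 * l + 1) 1 u)) (at u)" for u
    using DERIV_trig_cell[of "\<lambda>z. of_bool (z mod 2 ^ k = j)" "2 * l + 1" 0 u] by simp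
  then have "continuous_on UNIV (trig_cell (\<lambda>z. of_bool (z mod 2 ^ k = j)) (2 * l + 2) 0)"
    by (meson DERIV_isCont continuous_at_imp_continuous_on)
  then show ?thesis
    unfolding bump_eq_trig_cell
    by (rule continuous_on_compose2) (auto intro!: continuous_intros)
qed

text \<open>On the middle half of a cell the doubled angle has nonpositive cosine, so the squared
  sine is at least 1/2; the bump is its power of exponent l + 1.\<close>

lemma bump_lower_bound:
  assumes "j \<in> {0..<2 ^ k}" and "(real_of_int j + 1 / 4) / 2 ^ k \<le> x" and "x \<le> (real_of_int j + 3 / 4) / 2 ^ k"
  shows "(1 / 2) ^ (l + 1) \<le> bump l k j x"
proof -
  define u where "u = 2 ^ k * x - real_of_int j"
  have u: "1 / 4 \<le> u" "u \<le> 3 / 4"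
    using assms(2,3) by (auto simp: u_def field_simps)
  have ux: "2 ^ k * x = real_of_int j + u" by (simp add: u_def)
  have "\<lfloor>2 ^ k * x\<rfloor> = j"
    using u unfolding ux by (simp add: floor_unique)
  then have c: "cell k x = j" using assms(1) by (simp add: cell_def)
  have "1 / 2 \<le> sin (pi * (2 ^ k * x)) ^ 2"
  proof -
    have "cos (2 * (pi * (2 ^ k * x))) = cos (2 * pi * u + (2 * pi) * real_of_int j)"
      unfolding ux by (simp add: algebra_simps)
    also have "\<dots> = cos (2 * pi * u)"
      by (simp add: cos_add)
    also have "\<dots> = - cos (2 * pi * u - pi)" by (simp add: cos_diff)
    also have "\<dots> \<le> 0"
    proof -
      have "pi * (1 / 4) \<le> pi * u" "pi * u \<le> pi * (3 / 4)" using u by (intro mult_left_mono; simp)+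
      then have "0 \<le> cos (2 * pi * u - pi)" by (intro cos_ge_zero) linarith+
      then show ?thesis by simp
    qed
    finally show ?thesis unfolding cos_double_sin by simp
  qed
  then have "(1 / 2) ^ (l + 1) \<le> (sin (pi * (2 ^ k * x)) ^ 2) ^ (l + 1)"
    by (intro power_mono) auto
  also have "\<dots> = bump l k j x"
    unfolding power_mult[symmetric] by (simp add: bump_def c)
  finally show ?thesis .
qed

text \<open>Steps longer than a cell are handled by the trivial bound \<open>2 ^ l\<close>, shorter
  ones by the derivative bound after rescaling by \<open>2 ^ k\<close>; C is the larger of the two
  constants.\<close>

lemma fdiff_bump_bound:
  "\<exists>C\<ge>1. \<forall>k j s x. \<bar>fdiff l s (bump l k j) x\<bar> \<le> C * min 1 (2 ^ k * \<bar>s\<bar>) ^ l"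
proof -
  obtain M where M: "\<And>w. \<forall>z. \<bar>w z\<bar> \<le> 1 \<Longrightarrow> deriv_bounded l M (trig_cell w (2 * l + 2) 0)"
    using deriv_bounded_trig_cell[of l "2 * l + 2" 0] by auto
  define C where "C = max (2 ^ l) M"
  have "\<bar>fdiff l s (bump l k j) x\<bar> \<le> C * min 1 (2 ^ k * \<bar>s\<bar>) ^ l" for k j s x
  proof (cases "1 \<le> 2 ^ k * \<bar>s\<bar>")
    case True
    have "\<bar>fdiff l s (bump l k j) x\<bar> \<le> 2 ^ l * 1"
      by (rule abs_fdiff_le_sup) (simp add: bump_nonneg bump_le_1)
    then show ?thesis using True by (simp add: C_def)
  next
    case False
    have "\<bar>fdiff l s (bump l k j) x\<bar> \<le> M * \<bar>2 ^ k * s\<bar> ^ l"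
      unfolding bump_eq_trig_cell fdiff_scale[of l s "trig_cell _ _ _"]
      by (rule abs_fdiff_le_deriv[OF M]) auto
    also have "\<dots> \<le> C * (2 ^ k * \<bar>s\<bar>) ^ l"
      by (auto simp: C_def abs_mult intro!: mult_right_mono)
    finally show ?thesis using False by simp
  qed
  moreover have "1 \<le> C" by (simp add: C_def le_max_iff_disj)
  ultimately show ?thesis by blast
qed

text \<open>A difference of order l samples only l + 1 points, each in a single cell. Hence at most
  l + 1 of the \<open>2 ^ k\<close> summands are nonzero and the constant does not grow with
  k.\<close>

lemma sum_fdiff_bump_bound:
  "\<exists>C\<ge>1. \<forall>k s x. (\<Sum>j\<in>{0..<2 ^ k}. \<bar>fdiff l s (bump l k j) x\<bar>) \<le> C * min 1 (2 ^ k * \<bar>s\<bar>) ^ l"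
proof -
  obtain C where C: "1 \<le> C" "\<And>k j s x. \<bar>fdiff l s (bump l k j) x\<bar> \<le> C * min 1 (2 ^ k * \<bar>s\<bar>) ^ l"
    using fdiff_bump_bound by blast
  have "(\<Sum>j\<in>{0..<2 ^ k}. \<bar>fdiff l s (bump l k j) x\<bar>) \<le> (real (l + 1) * C) * min 1 (2 ^ k * \<bar>s\<bar>) ^ l" for k s x
  proof -
    define Z where "Z = (\<lambda>r. cell k (x + real r * s)) ` {..l}"
    have cZ: "card Z \<le> l + 1" unfolding Z_def using card_image_le[of "{..l}"] by simp
    have "fdiff l s (bump l k j) x = 0" if "j \<notin> Z" for j
      unfolding fdiff_def using that by (intro sum.neutral) (auto simp: Z_def intro!: bump_eq_0)
    then have "(\<Sum>j\<in>{0..<2 ^ k}. \<bar>fdiff l s (bump l k j) x\<bar>) = (\<Sum>j\<in>Z. \<bar>fdiff l s (bump l k j) x\<bar>)"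
      by (intro sum.mono_neutral_right) (auto simp: Z_def cell_in[simplified])
    also have "\<dots> \<le> (\<Sum>j\<in>Z. C * min 1 (2 ^ k * \<bar>s\<bar>) ^ l)"
      by (intro sum_mono C)
    also have "\<dots> = real (card Z) * (C * min 1 (2 ^ k * \<bar>s\<bar>) ^ l)" by simp
    also have "\<dots> \<le> real (l + 1) * (C * min 1 (2 ^ k * \<bar>s\<bar>) ^ l)"
      using cZ C(1) by (intro mult_right_mono) auto
    finally show ?thesis by (simp add: mult.assoc)
  qed
  moreover have "1 \<le> real (l + 1) * C"
    using C(1) mult_mono[of 1 "real (l + 1)" 1 C] by simp
  ultimately show ?thesis by blast
qed

lemma sum_bump_le_1: "(\<Sum>j\<in>{0..<2 ^ k}. \<bar>bump l k j x\<bar>) \<le> 1"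
proof -
  have "(\<Sum>j\<in>{0..<2 ^ k}. \<bar>bump l k j x\<bar>) = (\<Sum>j\<in>{cell k x}. \<bar>bump l k j x\<bar>)"
    by (intro sum.mono_neutral_right) (use cell_in[of k x] in \<open>auto intro!: bump_eq_0\<close>)
  then show ?thesis by (simp add: bump_nonneg bump_le_1)
qed

subsection \<open>Sums and integrals of the scaled decay function\<close>

text \<open>This is \<beta> of the overview: the smoothness weight times the bound on a difference
  whose step, measured in cell lengths, is v. Its value at v = 0 is 0.\<close>

definition decay :: "real \<Rightarrow> nat \<Rightarrow> real \<Rightarrow> real" where
  "decay \<alpha> l v = v powr (- \<alpha>) * min 1 v ^ l"

lemma decay_nonneg: "0 \<le> v \<Longrightarrow> 0 \<le> decay \<alpha> l v"
  by (simp add: decay_def)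

lemma decay_le_powr:
  assumes "\<delta> \<le> \<alpha>" and "\<delta> \<le> real l - \<alpha>" and "0 < v" and "0 < \<delta>"
  shows "decay \<alpha> l v \<le> min (v powr \<delta>) (v powr (- \<delta>))"
proof (cases "1 \<le> v")
  case True
  then have "decay \<alpha> l v = v powr (- \<alpha>)" by (simp add: decay_def)
  also have "\<dots> \<le> v powr (- \<delta>)" using True assms by (intro powr_mono) auto
  finally show ?thesis using powr_mono[of "-\<delta>" \<delta> v] assms(4) True by auto
next
  case False
  have "decay \<alpha> l v = v powr (real l - \<alpha>)"
    using False assms(3) by (simp add: decay_def powr_diff powr_minus powr_realpow field_simps)
  also have "\<dots> \<le> v powr \<delta>" using False assms by (intro powr_mono') auto
  finally show ?thesis using powr_mono'[of "-\<delta>" \<delta> v] assms(4) False assms(3) by auto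
qed

text \<open>The two-sided power bound is min(w, 1/w) with \<open>w = v powr (\<delta> * r)\<close>.
  It is replaced by w/(1 + w)^2 up to the factor 4, because this smooth majorant is tied to
  increments and derivatives of w/(1 + w): sums then telescope and integrals are explicit.\<close>

lemma decay_powr_le:
  assumes \<delta>: "0 < \<delta>" "\<delta> \<le> \<alpha>" "\<delta> \<le> real l - \<alpha>" and r: "0 < r" and v: "0 < v"
  shows "decay \<alpha> l v powr r \<le> 4 * (v powr (\<delta> * r) / (1 + v powr (\<delta> * r))\<^sup>2)"
proof -
  define w where "w = v powr (\<delta> * r)"
  have w0: "0 < w" using v by (simp add: w_def)
  have "decay \<alpha> l v powr r \<le> (min (v powr \<delta>) (v powr (- \<delta>))) powr r"
    using decay_nonneg[of v \<alpha> l] v r by (intro powr_mono2 decay_le_powr[OF \<delta>(2,3) v \<delta>(1)]) auto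
  also have "\<dots> \<le> min w (1 / w)"
  proof -
    have "(min (v powr \<delta>) (v powr (- \<delta>))) powr r \<le> (v powr \<delta>) powr r"
      "(min (v powr \<delta>) (v powr (- \<delta>))) powr r \<le> (v powr (- \<delta>)) powr r"
      using r by (intro powr_mono2; simp)+
    then show ?thesis unfolding w_def powr_powr by (simp add: powr_minus_divide)
  qed
  also have "\<dots> \<le> 4 * (w / (1 + w)\<^sup>2)"
  proof (cases "1 \<le> w")
    case True
    have "(1 + w)\<^sup>2 \<le> (2 * w)\<^sup>2" using True by (intro power_mono) auto
    then have "1 / w \<le> 4 * (w / (1 + w)\<^sup>2)"
      using w0 by (simp add: field_simps power2_eq_square)
    then show ?thesis by simp
  next
    case False
    have "(1 + w)\<^sup>2 \<le> 2\<^sup>2" using False w0 by (intro power_mono) auto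
    then have "w * (1 + w)\<^sup>2 \<le> w * 4" using w0 by (intro mult_left_mono) auto
    then have "w \<le> 4 * (w / (1 + w)\<^sup>2)"
      using w0 by (simp add: pos_le_divide_eq mult.commute)
    then show ?thesis by simp
  qed
  finally show ?thesis by (simp add: w_def)
qed

lemma decay_le_1:
  assumes "0 < \<alpha>" "\<alpha> < real l" "0 < v"
  shows "decay \<alpha> l v \<le> 1"
proof -
  define \<delta> where "\<delta> = min \<alpha> (real l - \<alpha>)"
  have "decay \<alpha> l v \<le> min (v powr \<delta>) (v powr (- \<delta>))"
    using assms by (intro decay_le_powr) (auto simp: \<delta>_def)
  also have "\<dots> \<le> 1"
    using powr_mono[of "-\<delta>" 0 v] powr_mono'[of 0 \<delta> v] assms
    by (cases "1 \<le> v") (auto simp: \<delta>_def min_def)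
  finally show ?thesis .
qed

text \<open>The summand is dominated by a multiple of the increment, over one doubling of the argument,
  of the bounded increasing function \<^term>\<open>w / (1 + w)\<close> with \<^term>\<open>w = v powr \<delta>\<close>.\<close>

lemma sum_decay_bounded:
  assumes "0 < \<alpha>" "\<alpha> < real l"
  shows "\<exists>B\<ge>1. \<forall>u>0. \<forall>Q. (\<Sum>j<Q. decay \<alpha> l (2 ^ j * u)) \<le> B"
proof -
  define \<delta> where "\<delta> = min \<alpha> (real l - \<alpha>)"
  have \<delta>: "0 < \<delta>" "\<delta> \<le> \<alpha>" "\<delta> \<le> real l - \<alpha>" using assms by (auto simp: \<delta>_def)
  define a where "a = 2 powr \<delta>"
  have a: "1 < a" using \<delta>(1) by (simp add: a_def)
  \<comment> \<open>Doubling v multiplies w by a. The 4 comes from the majorant, the numerator a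
    from 1 + a w \<le> a (1 + w), and a - 1 from the increment of w/(1 + w).\<close>
  define C where "C = 4 * a / (a - 1)"
  have C: "1 \<le> C" using a by (simp add: C_def field_simps)
  define \<Phi> where "\<Phi> v = v powr \<delta> / (1 + v powr \<delta>)" for v :: real
  have step: "decay \<alpha> l v \<le> C * (\<Phi> (2 * v) - \<Phi> v)" if v: "0 < v" for v
  proof -
    define w where "w = v powr \<delta>"
    have w0: "0 < w" using v by (simp add: w_def)
    have "decay \<alpha> l v \<le> 4 * (w / (1 + w)\<^sup>2)"
      using decay_powr_le[OF \<delta>, of 1 v] v decay_nonneg[of v \<alpha> l] by (simp add: w_def)
    also have "\<dots> \<le> 4 * (a * w / ((1 + w) * (1 + a * w)))"
    proof -
      have "w / (1 + w)\<^sup>2 = a * w / ((1 + w) * (a * (1 + w)))"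
        using a by (simp add: power2_eq_square)
      also have "\<dots> \<le> a * w / ((1 + w) * (1 + a * w))"
        using w0 a by (intro divide_left_mono mult_left_mono mult_pos_pos add_pos_pos)
          (auto simp: algebra_simps)
      finally have "w / (1 + w)\<^sup>2 \<le> a * w / ((1 + w) * (1 + a * w))" .
      then show ?thesis by simp
    qed
    also have "\<dots> = C * ((a - 1) * w / ((1 + w) * (1 + a * w)))"
      using a by (simp add: C_def)
    also have "(a - 1) * w / ((1 + w) * (1 + a * w)) = a * w / (1 + a * w) - w / (1 + w)"
    proof -
      have "1 + w \<noteq> 0" "1 + a * w \<noteq> 0" using w0 a by (auto simp: add_pos_pos less_imp_neq[symmetric])
      then show ?thesis by (simp add: divide_simps) (simp add: algebra_simps)
    qed
    also have "\<dots> = \<Phi> (2 * v) - \<Phi> v"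
      using v by (simp add: \<Phi>_def w_def a_def powr_mult)
    finally show ?thesis .
  qed
  have "(\<Sum>j<Q. decay \<alpha> l (2 ^ j * u)) \<le> C" if u: "0 < u" for u Q
  proof -
    have "(\<Sum>j<Q. decay \<alpha> l (2 ^ j * u)) \<le> (\<Sum>j<Q. C * (\<Phi> (2 ^ Suc j * u) - \<Phi> (2 ^ j * u)))"
      using u step[of "2 ^ _ * u"] by (intro sum_mono) (simp add: mult.assoc)
    also have "\<dots> = C * (\<Phi> (2 ^ Q * u) - \<Phi> u)"
      unfolding sum_distrib_left[symmetric] by (subst sum_lessThan_telescope) simp
    also have "\<dots> \<le> C * 1"
    proof (rule mult_left_mono)
      have "\<Phi> v \<le> 1" "0 \<le> \<Phi> v" for v by (simp_all add: \<Phi>_def divide_simps add_pos_nonneg)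
      then show "\<Phi> (2 ^ Q * u) - \<Phi> u \<le> 1" by (smt (verit))
    qed (use C in auto)
    finally show ?thesis by simp
  qed
  with C show ?thesis by blast
qed

text \<open>With \<open>W t = (\<kappa> * t) powr \<gamma>\<close> the majorant divided by t is a
  multiple of the derivative of W/(1 + W). This primitive stays between 0 and 1 for every \<kappa>,
  so D is independent of the dyadic scale.\<close>

lemma nn_integral_decay_bounded:
  assumes "0 < \<alpha>" "\<alpha> < real l" and r: "0 < r"
  shows "\<exists>D\<ge>1. \<forall>\<kappa>>0.
    (\<integral>\<^sup>+t. ennreal (indicator {0..1} t * (decay \<alpha> l (\<kappa> * t) powr r * inverse t)) \<partial>lborel) \<le> ennreal D"
proof -
  define \<delta> where "\<delta> = min \<alpha> (real l - \<alpha>)"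
  have \<delta>: "0 < \<delta>" "\<delta> \<le> \<alpha>" "\<delta> \<le> real l - \<alpha>" using assms by (auto simp: \<delta>_def)
  define \<gamma> where "\<gamma> = \<delta> * r"
  have \<gamma>: "0 < \<gamma>" using \<delta>(1) r by (simp add: \<gamma>_def)
  \<comment> \<open>The maximum with 1 lets D also bound the integrals over coordinates outside e,
    which are 1.\<close>
  define D where "D = max 1 (4 / \<gamma>)"
  have "(\<integral>\<^sup>+t. ennreal (indicator {0..1} t * (decay \<alpha> l (\<kappa> * t) powr r * inverse t)) \<partial>lborel) \<le> ennreal D"
    if \<kappa>: "0 < \<kappa>" for \<kappa>
  proof -
    define W where "W t = (\<kappa> * t) powr \<gamma>" for t
    define F where "F t = W t / (1 + W t)" for t
    define f where "f t = \<gamma> * (W t / (1 + W t)\<^sup>2) * inverse t" for t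
    have W0: "0 \<le> W t" for t by (simp add: W_def)
    have "(f has_integral (F 1 - F 0)) {0..1}"
    \<comment> \<open>For \<gamma> < 1 the function W has no finite derivative at 0, so
      differentiability is asserted in the open interval only.\<close>
    proof (rule fundamental_theorem_of_calculus_interior)
      have "continuous_on {0..1} W"
        unfolding W_def using \<gamma> \<kappa> by (intro continuous_on_powr' continuous_intros) auto
      then show "continuous_on {0..1} F"
        unfolding F_def using W0 by (intro continuous_intros) (auto simp: add_pos_nonneg less_imp_neq[symmetric])
    next
      fix t :: real assume t: "t \<in> {0<..<1}"
      have "(W has_real_derivative \<gamma> * W t * inverse t) (at t)"
        unfolding W_def using t \<kappa> by (auto intro!: derivative_eq_intros simp: powr_diff field_simps)
      then have "(F has_real_derivative
          ((\<gamma> * W t * inverse t) * (1 + W t) - W t * (\<gamma> * W t * inverse t)) / ((1 + W t) * (1 + W t))) (at t)"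
        unfolding F_def using W0[of t] by (auto intro!: derivative_eq_intros)
      then have "(F has_real_derivative f t) (at t)"
        by (rule DERIV_cong) (simp add: f_def power2_eq_square algebra_simps)
      then show "(F has_vector_derivative f t) (at t)"
        by (simp add: has_real_derivative_iff_has_vector_derivative)
    qed auto
    then have "((\<lambda>t. indicator {0..1} t * f t) has_integral (F 1 - F 0)) UNIV"
    proof -
      have "(\<lambda>t. indicator {0..1} t * f t) = (\<lambda>t. if t \<in> {0..1} then f t else 0)"
        by (auto simp: fun_eq_iff)
      then show ?thesis
        using \<open>(f has_integral (F 1 - F 0)) {0..1}\<close> by (simp only: has_integral_restrict_UNIV)
    qed
    then have f_int: "(\<integral>\<^sup>+t. ennreal (indicator {0..1} t * f t) \<partial>lborel) = ennreal (F 1 - F 0)"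
    proof (rule nn_integral_has_integral_lborel[rotated 2])
      show "(\<lambda>t. indicator {0..1} t * f t) \<in> borel_measurable borel"
        unfolding f_def W_def by measurable
      show "0 \<le> indicator {0..1} t * f t" for t
        using W0 \<gamma> by (cases "0 \<le> t") (auto simp: f_def indicator_def)
    qed
    have "(\<integral>\<^sup>+t. ennreal (indicator {0..1} t * (decay \<alpha> l (\<kappa> * t) powr r * inverse t)) \<partial>lborel)
      \<le> (\<integral>\<^sup>+t. ennreal (4 / \<gamma>) * ennreal (indicator {0..1} t * f t) \<partial>lborel)"
    proof (intro nn_integral_mono)
      fix t :: real
      have "indicator {0..1} t * (decay \<alpha> l (\<kappa> * t) powr r * inverse t)
        \<le> (4 / \<gamma>) * (indicator {0..1} t * f t)"
      proof (cases "t \<in> {0<..1}")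
        case True
        then have "decay \<alpha> l (\<kappa> * t) powr r * inverse t \<le> 4 * (W t / (1 + W t)\<^sup>2) * inverse t"
          unfolding W_def \<gamma>_def using \<kappa> r by (intro mult_right_mono decay_powr_le[OF \<delta>]) auto
        then show ?thesis using True \<gamma> by (simp add: f_def)
      next
        \<comment> \<open>At t = 0 both sides are 0, because \<open>inverse 0 = 0\<close>.\<close>
        case False
        then show ?thesis by (cases "t = 0") (auto simp: f_def indicator_def)
      qed
      then show "ennreal (indicator {0..1} t * (decay \<alpha> l (\<kappa> * t) powr r * inverse t))
        \<le> ennreal (4 / \<gamma>) * ennreal (indicator {0..1} t * f t)"
        using \<gamma> by (subst ennreal_mult'[symmetric]) (auto intro: ennreal_leI)
    qed
    also have "\<dots> = ennreal (4 / \<gamma>) * ennreal (F 1 - F 0)"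
      unfolding f_int[symmetric] by (rule nn_integral_cmult) (unfold f_def W_def, measurable)
    also have "\<dots> \<le> ennreal (4 / \<gamma>) * ennreal 1"
    proof (intro mult_left_mono ennreal_leI)
      have "F 1 \<le> 1" "F 0 = 0" using W0[of 1] \<gamma> by (simp_all add: F_def W_def divide_simps add_pos_nonneg)
      then show "F 1 - F 0 \<le> 1" by simp
    qed auto
    also have "\<dots> \<le> ennreal D" by (auto simp: D_def intro: ennreal_leI)
    finally show ?thesis .
  qed
  moreover have "1 \<le> D" by (simp add: D_def)
  ultimately show ?thesis by blast
qed

section \<open>Products over coordinates and dyadic levels\<close>

text \<open>Tonelli, carried over from products indexed by \<open>Basis\<close> to products indexed
  by coordinates; \<open>ix\<close> recovers the index of a basis vector.\<close>

lemma nn_integral_lborel_prod_vec: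
  fixes g :: "'d::finite \<Rightarrow> real \<Rightarrow> ennreal"
  assumes "\<And>i. g i \<in> borel_measurable borel"
  shows "(\<integral>\<^sup>+x. (\<Prod>i\<in>UNIV. g i (x $ i)) \<partial>lborel) = (\<Prod>i\<in>UNIV. \<integral>\<^sup>+s. g i s \<partial>lborel)"
proof -
  define ix where "ix b = (THE i. b = axis i (1::real))" for b :: "real ^ 'd"
  have ix: "ix (axis i 1) = i" for i
    unfolding ix_def by (rule the_equality) (auto simp: axis_eq_axis)
  have B: "(Basis :: (real ^ 'd) set) = (\<lambda>i. axis i 1) ` UNIV" and inj: "inj (\<lambda>i::'d. axis i (1::real))"
    by (auto simp: Basis_vec_def inj_on_def axis_eq_axis)
  have "(\<integral>\<^sup>+x. (\<Prod>b\<in>Basis. g (ix b) (x \<bullet> b)) \<partial>lborel) = (\<Prod>b\<in>(Basis :: (real ^ 'd) set). \<integral>\<^sup>+s. g (ix b) s \<partial>lborel)"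
    by (rule nn_integral_lborel_prod) (use assms in auto)
  then show ?thesis
    unfolding B by (simp add: prod.reindex[OF inj] ix cart_eq_inner_axis[symmetric])
qed

lemma nn_integral_prod_decay_le:
  fixes e :: "'d::finite set" and k :: "'d \<Rightarrow> nat"
  assumes D: "1 \<le> D" "\<And>\<kappa>. 0 < \<kappa> \<Longrightarrow>
    (\<integral>\<^sup>+t. ennreal (indicator {0..1} t * (decay \<alpha> l (\<kappa> * t) powr r * inverse t)) \<partial>lborel) \<le> ennreal D"
  shows "(\<integral>\<^sup>+t\<in>cbox 0 1. ennreal (\<Prod>i\<in>e. decay \<alpha> l (2 ^ k i * t $ i) powr r * inverse (t $ i)) \<partial>lborel)
    \<le> ennreal (D ^ CARD('d))"
proof -
  define g where "g i s = ennreal (indicator {0..1} s *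
    (if i \<in> e then decay \<alpha> l (2 ^ k i * s) powr r * inverse s else 1))" for i s
  have "(\<integral>\<^sup>+t\<in>cbox 0 1. ennreal (\<Prod>i\<in>e. decay \<alpha> l (2 ^ k i * t $ i) powr r * inverse (t $ i)) \<partial>lborel)
    = (\<integral>\<^sup>+t. (\<Prod>i\<in>UNIV. g i (t $ i)) \<partial>lborel)"
  proof (intro nn_integral_cong)
    fix t :: "real ^ 'd"
    show "ennreal (\<Prod>i\<in>e. decay \<alpha> l (2 ^ k i * t $ i) powr r * inverse (t $ i)) * indicator (cbox 0 1) t
      = (\<Prod>i\<in>UNIV. g i (t $ i))"
    proof (cases "t \<in> cbox 0 1")
      case True
      then have t: "0 \<le> t $ i \<and> t $ i \<le> 1" for i by (simp add: mem_box_cart)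
      have "(\<Prod>i\<in>UNIV. g i (t $ i)) = (\<Prod>i\<in>UNIV. ennreal (if i \<in> e then decay \<alpha> l (2 ^ k i * t $ i) powr r * inverse (t $ i) else 1))"
        using t by (intro prod.cong) (auto simp: g_def)
      also have "\<dots> = ennreal (\<Prod>i\<in>UNIV. if i \<in> e then decay \<alpha> l (2 ^ k i * t $ i) powr r * inverse (t $ i) else 1)"
        using t by (intro prod_ennreal) auto
      also have "(\<Prod>i\<in>UNIV. if i \<in> e then decay \<alpha> l (2 ^ k i * t $ i) powr r * inverse (t $ i) else 1)
        = (\<Prod>i\<in>e. decay \<alpha> l (2 ^ k i * t $ i) powr r * inverse (t $ i))"
        by (subst prod.inter_restrict[symmetric]) auto
      finally show ?thesis using True by simp
    next
      case False
      then obtain i where "\<not> (0 \<le> t $ i \<and> t $ i \<le> 1)" by (auto simp: mem_box_cart)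
      then have "g i (t $ i) = 0" by (auto simp: g_def)
      then have "(\<Prod>i\<in>UNIV. g i (t $ i)) = 0" by (intro prod_zero) auto
      then show ?thesis using False by simp
    qed
  qed
  also have "\<dots> = (\<Prod>i\<in>UNIV. \<integral>\<^sup>+s. g i s \<partial>lborel)"
    by (rule nn_integral_lborel_prod_vec) (unfold g_def decay_def, measurable)
  also have "\<dots> \<le> (\<Prod>i\<in>(UNIV::'d set). ennreal D)"
  proof (intro prod_mono_ennreal)
    fix i
    show "(\<integral>\<^sup>+s. g i s \<partial>lborel) \<le> ennreal D"
    proof (cases "i \<in> e")
      case True
      then show ?thesis using D(2)[of "2 ^ k i"] by (simp add: g_def)
    next
      case False
      then have "g i = indicator {0..1}"
        by (simp add: g_def fun_eq_iff indicator_def)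
      then show ?thesis using D(1) ennreal_leI[OF D(1)] by simp
    qed
  qed
  also have "\<dots> = ennreal (D ^ CARD('d))" using D(1) by (simp add: ennreal_power)
  finally show ?thesis .
qed

text \<open>The dyadic levels of total size \<open>m\<close> are parametrised by their coordinates other than \<open>i0\<close>.\<close>

definition lev :: "nat \<Rightarrow> 'd \<Rightarrow> ('d::finite \<Rightarrow> nat) \<Rightarrow> 'd \<Rightarrow> nat" where
  "lev m i0 k = k(i0 := m - (\<Sum>i\<in>UNIV - {i0}. k i))"

definition levels :: "nat \<Rightarrow> 'd \<Rightarrow> ('d::finite \<Rightarrow> nat) set" where
  "levels Q i0 = (UNIV - {i0}) \<rightarrow>\<^sub>E {..<Q}"

lemma finite_levels: "finite (levels Q i0)"
  unfolding levels_def by (intro finite_PiE) auto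

lemma card_levels: "card (levels Q (i0 :: 'd::finite)) = Q ^ (CARD('d) - 1)"
  unfolding levels_def by (subst card_PiE) auto

text \<open>Each free coordinate is at most Q - 1, so under the size condition on m the truncated
  subtraction in the coordinate i0 is exact.\<close>

lemma sum_lev:
  assumes "k \<in> levels Q i0" and "CARD('d) * (Q - 1) \<le> m"
  shows "(\<Sum>i\<in>UNIV. lev m (i0 :: 'd::finite) k i) = m"
proof -
  have "(\<Sum>i\<in>UNIV - {i0}. k i) \<le> (\<Sum>i\<in>UNIV - {i0}. Q - 1)"
  proof (rule sum_mono)
    fix i assume "i \<in> UNIV - {i0}"
    then have "k i < Q" using assms(1) by (auto simp: levels_def PiE_iff)
    then show "k i \<le> Q - 1" by simp
  qed
  also have "\<dots> \<le> CARD('d) * (Q - 1)" by (simp add: mult_right_mono)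
  finally have *: "(\<Sum>i\<in>UNIV - {i0}. k i) \<le> m" using assms(2) by linarith
  have "(\<Sum>i\<in>UNIV. lev m i0 k i) = lev m i0 k i0 + (\<Sum>i\<in>UNIV - {i0}. lev m i0 k i)"
    by (rule sum.remove) auto
  also have "(\<Sum>i\<in>UNIV - {i0}. lev m i0 k i) = (\<Sum>i\<in>UNIV - {i0}. k i)"
    by (intro sum.cong) (auto simp: lev_def)
  finally show ?thesis using * by (simp add: lev_def)
qed

text \<open>The factor at the dependent coordinate i0 is at most 1 and is dropped. The other
  coordinates range independently, so the sum of products becomes a product of one-variable sums,
  each at most B.\<close>

lemma sum_prod_decay_le:
  fixes \<tau> :: "'d::finite \<Rightarrow> real"
  assumes \<alpha>: "0 < \<alpha>" "\<alpha> < real l" and \<tau>: "\<And>i. 0 < \<tau> i"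
    and B: "1 \<le> B" "\<And>u. 0 < u \<Longrightarrow> (\<Sum>j<Q. decay \<alpha> l (2 ^ j * u)) \<le> B"
  shows "(\<Sum>k\<in>levels Q i0. \<Prod>i\<in>UNIV. decay \<alpha> l (2 ^ lev m i0 k i * \<tau> i)) \<le> B ^ CARD('d)"
proof -
  have nn: "0 \<le> decay \<alpha> l (2 ^ j * \<tau> i)" for i j
    using \<tau>[of i] by (intro decay_nonneg) simp
  have "(\<Sum>k\<in>levels Q i0. \<Prod>i\<in>UNIV. decay \<alpha> l (2 ^ lev m i0 k i * \<tau> i))
    \<le> (\<Sum>k\<in>levels Q i0. \<Prod>i\<in>UNIV - {i0}. decay \<alpha> l (2 ^ k i * \<tau> i))"
  proof (rule sum_mono)
    fix k
    have "(\<Prod>i\<in>UNIV. decay \<alpha> l (2 ^ lev m i0 k i * \<tau> i))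
      = decay \<alpha> l (2 ^ lev m i0 k i0 * \<tau> i0) * (\<Prod>i\<in>UNIV - {i0}. decay \<alpha> l (2 ^ lev m i0 k i * \<tau> i))"
      by (rule prod.remove) auto
    also have "\<dots> \<le> 1 * (\<Prod>i\<in>UNIV - {i0}. decay \<alpha> l (2 ^ lev m i0 k i * \<tau> i))"
      using \<alpha> \<tau> by (intro mult_right_mono decay_le_1 prod_nonneg) (auto simp: nn)
    also have "\<dots> = (\<Prod>i\<in>UNIV - {i0}. decay \<alpha> l (2 ^ k i * \<tau> i))"
      by (simp, intro prod.cong) (auto simp: lev_def)
    finally show "(\<Prod>i\<in>UNIV. decay \<alpha> l (2 ^ lev m i0 k i * \<tau> i))
      \<le> (\<Prod>i\<in>UNIV - {i0}. decay \<alpha> l (2 ^ k i * \<tau> i))" .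
  qed
  also have "\<dots> = (\<Prod>i\<in>UNIV - {i0}. \<Sum>j<Q. decay \<alpha> l (2 ^ j * \<tau> i))"
    unfolding levels_def by (rule prod_sum_PiE[symmetric]) auto
  also have "\<dots> \<le> (\<Prod>i\<in>UNIV - {i0}. B)"
    using \<tau> by (intro prod_mono conjI B sum_nonneg nn)
  also have "\<dots> = B ^ (CARD('d) - 1)" by simp
  also have "\<dots> \<le> B ^ CARD('d)" using B(1) by (intro power_increasing) auto
  finally show ?thesis .
qed

subsection \<open>Besov norm of the fooling function\<close>

lemma prod_if_mem:
  "(\<Prod>i\<in>UNIV. if i \<in> e then f i else 1) = (\<Prod>i\<in>(e :: 'd::finite set). f i)"
  using prod.inter_restrict[of UNIV f e] by simp

text \<open>A difference in direction i touches only the i-th factor, so finite sums of tensor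
  products are preserved and the directions can be treated one after another.\<close>

lemma partial_diff_tensor:
  fixes g :: "'a \<Rightarrow> 'd::finite \<Rightarrow> real \<Rightarrow> real"
  shows "partial_diff l i s (\<lambda>x. \<Sum>\<iota>\<in>I. c \<iota> * (\<Prod>k\<in>UNIV. g \<iota> k (x $ k)))
    = (\<lambda>x. \<Sum>\<iota>\<in>I. c \<iota> * (\<Prod>k\<in>UNIV. (if k = i then fdiff l s (g \<iota> k) else g \<iota> k) (x $ k)))"
proof
  fix x :: "real ^ 'd"
  let ?P = "\<lambda>\<iota>. \<Prod>k\<in>UNIV - {i}. g \<iota> k (x $ k)"
  have P: "(\<Prod>k\<in>UNIV. g \<iota> k ((x + (real j * s) *\<^sub>R axis i 1) $ k)) = g \<iota> i (x $ i + real j * s) * ?P \<iota>" for \<iota> j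
  proof -
    have "(\<Prod>k\<in>UNIV. g \<iota> k ((x + (real j * s) *\<^sub>R axis i 1) $ k))
      = g \<iota> i ((x + (real j * s) *\<^sub>R axis i 1) $ i) * (\<Prod>k\<in>UNIV - {i}. g \<iota> k ((x + (real j * s) *\<^sub>R axis i 1) $ k))"
      by (rule prod.remove) auto
    also have "(\<Prod>k\<in>UNIV - {i}. g \<iota> k ((x + (real j * s) *\<^sub>R axis i 1) $ k)) = ?P \<iota>"
      by (intro prod.cong) (auto simp: axis_def)
    finally show ?thesis by simp
  qed
  have "partial_diff l i s (\<lambda>x. \<Sum>\<iota>\<in>I. c \<iota> * (\<Prod>k\<in>UNIV. g \<iota> k (x $ k))) x
    = (\<Sum>\<iota>\<in>I. \<Sum>j\<le>l. (-1) ^ (l - j) * real (l choose j) * (c \<iota> * (g \<iota> i (x $ i + real j * s) * ?P \<iota>)))"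
    unfolding partial_diff_def P sum_distrib_left by (rule sum.swap)
  also have "\<dots> = (\<Sum>\<iota>\<in>I. c \<iota> * (fdiff l s (g \<iota> i) (x $ i) * ?P \<iota>))"
    by (intro sum.cong) (auto simp: fdiff_def sum_distrib_left sum_distrib_right mult_ac)
  also have "\<dots> = (\<Sum>\<iota>\<in>I. c \<iota> * (\<Prod>k\<in>UNIV. (if k = i then fdiff l s (g \<iota> k) else g \<iota> k) (x $ k)))"
  proof (intro sum.cong refl arg_cong[where f = "\<lambda>y. c _ * y"])
    fix \<iota>
    have "(\<Prod>k\<in>UNIV. (if k = i then fdiff l s (g \<iota> k) else g \<iota> k) (x $ k))
      = (if i = i then fdiff l s (g \<iota> i) else g \<iota> i) (x $ i)
        * (\<Prod>k\<in>UNIV - {i}. (if k = i then fdiff l s (g \<iota> k) else g \<iota> k) (x $ k))"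
      by (rule prod.remove) auto
    also have "(\<Prod>k\<in>UNIV - {i}. (if k = i then fdiff l s (g \<iota> k) else g \<iota> k) (x $ k)) = ?P \<iota>"
      by (intro prod.cong) auto
    finally show "fdiff l s (g \<iota> i) (x $ i) * ?P \<iota>
      = (\<Prod>k\<in>UNIV. (if k = i then fdiff l s (g \<iota> k) else g \<iota> k) (x $ k))" by simp
  qed
  finally show "partial_diff l i s (\<lambda>x. \<Sum>\<iota>\<in>I. c \<iota> * (\<Prod>k\<in>UNIV. g \<iota> k (x $ k))) x
    = (\<Sum>\<iota>\<in>I. c \<iota> * (\<Prod>k\<in>UNIV. (if k = i then fdiff l s (g \<iota> k) else g \<iota> k) (x $ k)))" .
qed

lemma mixed_diff_tensor:
  fixes g :: "'a \<Rightarrow> 'd::finite \<Rightarrow> real \<Rightarrow> real"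
  shows "mixed_diff l e h (\<lambda>x. \<Sum>\<iota>\<in>I. c \<iota> * (\<Prod>k\<in>UNIV. g \<iota> k (x $ k)))
    = (\<lambda>x. \<Sum>\<iota>\<in>I. c \<iota> * (\<Prod>k\<in>UNIV. (if k \<in> e then fdiff l (h $ k) (g \<iota> k) else g \<iota> k) (x $ k)))"
proof (induction e rule: finite_induct[OF finite])
  case 1
  then show ?case by (simp add: mixed_diff_empty)
next
  case (2 i e)
  show ?case
    unfolding mixed_diff_insert[OF 2(2)] 2(3)
      partial_diff_tensor[where g = "\<lambda>\<iota> k. if k \<in> e then fdiff l (h $ k) (g \<iota> k) else g \<iota> k"]
    using 2(2) by (intro ext sum.cong refl arg_cong[where f = "\<lambda>y. c _ * y"] prod.cong) auto
qed

lemma continuous_mixed_diff: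
  fixes f :: "real ^ 'd::finite \<Rightarrow> real"
  assumes "continuous_on UNIV f"
  shows "continuous_on UNIV (mixed_diff l e h f)"
proof (induction e rule: finite_induct[OF finite])
  case 1
  then show ?case using assms by (simp add: mixed_diff_empty)
next
  case (2 i e)
  have "continuous_on UNIV (\<lambda>x. mixed_diff l e h f (x + c))" for c
    by (rule continuous_on_compose2[OF 2(3)]) (auto intro!: continuous_intros)
  then show ?case
    unfolding mixed_diff_insert[OF 2(2)] partial_diff_def by (intro continuous_intros)
qed

section \<open>Bounding the norms by suprema\<close>

lemma ennreal_powr_ennreal: "0 \<le> x \<Longrightarrow> ennreal_powr (ennreal x) r = ennreal (x powr r)"
  by (simp add: ennreal_powr_def)

lemma ennreal_powr_mono:
  assumes "x \<le> y" "0 \<le> r"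
  shows "ennreal_powr x r \<le> ennreal_powr y r"
proof (cases "y = top")
  case False
  then have "x \<noteq> top" "enn2real x \<le> enn2real y"
    using assms(1) by (auto simp: top.extremum_unique less_top enn2real_mono)
  then show ?thesis using False assms(2)
    by (auto simp: ennreal_powr_def intro!: ennreal_leI powr_mono2)
qed (simp add: ennreal_powr_def)

lemma emeasure_unit_cbox: "emeasure lborel (cbox 0 1 :: (real ^ 'd::finite) set) = 1"
  by (simp add: emeasure_lborel_cbox_eq Basis_vec_def inner_axis prod.neutral)

text \<open>The unit cube has measure 1, so a sup bound controls every p at once, also below 1. From
  here on p plays no part in the estimates.\<close>

lemma Lp_norm_le_sup:
  fixes g :: "real ^ 'd::finite \<Rightarrow> real"
  assumes "0 < p" and g: "continuous_on UNIV g" and W: "\<And>x. \<bar>g x\<bar> \<le> W"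
  shows "Lp_norm p g \<le> ennreal W"
proof (cases "p = top")
  case True
  have "g \<in> borel_measurable borel" using g by (rule borel_measurable_continuous_onI)
  then have "(\<lambda>x. ennreal \<bar>g x\<bar>) \<in> borel_measurable (restrict_space lborel (cbox 0 1))"
    by (intro measurable_restrict_space1) simp
  then have "esssup (restrict_space lborel (cbox 0 1)) (\<lambda>x. ennreal \<bar>g x\<bar>) \<le> ennreal W"
    by (rule esssup_I) (auto intro: ennreal_leI W)
  then show ?thesis by (simp add: Lp_norm_def True)
next
  case False
  define q where "q = enn2real p"
  have q: "0 < q" using False \<open>0 < p\<close> by (simp add: q_def enn2real_positive_iff less_top)
  have W0: "0 \<le> W" using W[of 0] by linarith
  have "(\<integral>\<^sup>+x\<in>cbox 0 1. ennreal (\<bar>g x\<bar> powr q) \<partial>lborel) \<le> (\<integral>\<^sup>+x\<in>(cbox 0 1 :: (real ^ 'd) set). ennreal (W powr q) \<partial>lborel)"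
    using q W by (intro nn_integral_mono mult_right_mono ennreal_leI powr_mono2) auto
  also have "\<dots> = ennreal (W powr q)"
    by (subst nn_integral_cmult_indicator) (auto simp: emeasure_unit_cbox)
  finally have "Lp_norm p g \<le> ennreal_powr (ennreal (W powr q)) (1 / q)"
    unfolding Lp_norm_def q_def[symmetric] using False q by (auto intro!: ennreal_powr_mono)
  also have "\<dots> = ennreal W" using q W0 by (simp add: ennreal_powr_ennreal powr_powr)
  finally show ?thesis .
qed

section \<open>The fooling function and its seminorms\<close>

text \<open>The constants C and B enter through their defining estimates, so they can be fixed
  before n, while A, m, Q and J depend on n or on the nodes. The set \<open>J k\<close> stands for
  the boxes of one level that carry a bump.\<close>

locale fooling =
  fixes \<alpha> A C B :: real and l m Q :: nat and i0 :: "'d::finite" and J :: "('d \<Rightarrow> nat) \<Rightarrow> ('d \<Rightarrow> int) set"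
  assumes \<alpha>: "0 < \<alpha>" "\<alpha> < real l" and A: "0 \<le> A"
    and C: "1 \<le> C" "\<And>k s x. (\<Sum>j\<in>{0..<2 ^ k}. \<bar>fdiff l s (bump l k j) x\<bar>) \<le> C * min 1 (2 ^ k * \<bar>s\<bar>) ^ l"
    and B: "1 \<le> B" "\<And>u. 0 < u \<Longrightarrow> (\<Sum>j<Q. decay \<alpha> l (2 ^ j * u)) \<le> B"
    and Q: "1 \<le> Q" "CARD('d) * (Q - 1) \<le> m"
    and J: "\<And>k. k \<in> levels Q i0 \<Longrightarrow> J k \<subseteq> PiE UNIV (\<lambda>i. {0..<2 ^ lev m i0 k i})"
begin

abbreviation "K \<equiv> levels Q i0"
abbreviation "L \<equiv> lev m i0"
abbreviation "boxes k \<equiv> PiE (UNIV :: 'd set) (\<lambda>i. {0..<2 ^ L k i :: int})"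

definition fool :: "real ^ 'd \<Rightarrow> real" where
  "fool x = (\<Sum>k\<in>K. \<Sum>j\<in>J k. A * (\<Prod>i\<in>UNIV. bump l (L k i) (j i) (x $ i)))"

lemma finite_boxes: "finite (boxes k)"
  by (intro finite_PiE) auto

lemma finite_J: "k \<in> K \<Longrightarrow> finite (J k)"
  using J finite_boxes by (rule finite_subset)

lemma card_K_pos: "1 \<le> real (card K)"
  using Q(1) by (simp add: card_levels)

lemma fool_Sigma:
  "fool = (\<lambda>x. \<Sum>\<iota>\<in>Sigma K J. A * (\<Prod>i\<in>UNIV. bump l (L (fst \<iota>) i) (snd \<iota> i) (x $ i)))"
  unfolding fool_def using finite_levels[of Q i0] finite_J
  by (subst sum.Sigma) (auto simp: case_prod_beta)

lemma continuous_fool: "continuous_on UNIV fool"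
proof -
  have "continuous_on UNIV (\<lambda>x::real ^ 'd. bump l k j (x $ i))" for k j i
    by (rule continuous_on_compose2[OF continuous_bump]) (auto intro!: continuous_intros)
  then show ?thesis unfolding fool_def by (intro continuous_intros)
qed

lemma periodic_fool: "periodic1 fool"
proof -
  have "bump l k j ((x + axis i' 1) $ i) = bump l k j (x $ i)" for k j i i' and x :: "real ^ 'd"
    by (cases "i = i'") (auto simp: axis_def bump_periodic)
  then show ?thesis by (simp add: periodic1_def fool_def)
qed

lemma mixed_diff_fool_le:
  "\<bar>mixed_diff l e h fool x\<bar> \<le> A * C ^ CARD('d) * (\<Sum>k\<in>K. \<Prod>i\<in>e. min 1 (2 ^ L k i * \<bar>h $ i\<bar>) ^ l)"
proof -
  define \<phi> where "\<phi> k i z = \<bar>(if i \<in> e then fdiff l (h $ i) (bump l (L k i) z) else bump l (L k i) z) (x $ i)\<bar>" for k i z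
  have "\<bar>mixed_diff l e h fool x\<bar> \<le> (\<Sum>\<iota>\<in>Sigma K J. A * (\<Prod>i\<in>UNIV. \<phi> (fst \<iota>) i (snd \<iota> i)))"
    unfolding fool_Sigma
      mixed_diff_tensor[where g = "\<lambda>\<iota> i. bump l (L (fst \<iota>) i) (snd \<iota> i)"]
    by (rule order_trans[OF sum_abs]) (use A in \<open>simp add: abs_mult abs_prod \<phi>_def\<close>)
  also have "\<dots> = (\<Sum>k\<in>K. \<Sum>j\<in>J k. A * (\<Prod>i\<in>UNIV. \<phi> k i (j i)))"
    using finite_levels[of Q i0] finite_J by (subst sum.Sigma) (auto simp: case_prod_beta)
  \<comment> \<open>All terms are nonnegative, so \<open>J k\<close> may be enlarged to the full
    product set of boxes; only then does the sum factor over coordinates.\<close>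
  also have "\<dots> \<le> (\<Sum>k\<in>K. \<Sum>j\<in>boxes k. A * (\<Prod>i\<in>UNIV. \<phi> k i (j i)))"
    using J finite_boxes A by (intro sum_mono sum_mono2) (auto intro!: mult_nonneg_nonneg prod_nonneg simp: \<phi>_def)
  also have "\<dots> = A * (\<Sum>k\<in>K. \<Prod>i\<in>UNIV. \<Sum>z\<in>{0..<2 ^ L k i}. \<phi> k i z)"
    by (simp add: sum_distrib_left prod_sum_PiE)
  also have "\<dots> \<le> A * (\<Sum>k\<in>K. C ^ CARD('d) * (\<Prod>i\<in>e. min 1 (2 ^ L k i * \<bar>h $ i\<bar>) ^ l))"
  proof (intro mult_left_mono sum_mono A)
    fix k
    have "(\<Prod>i\<in>UNIV. \<Sum>z\<in>{0..<2 ^ L k i}. \<phi> k i z)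
      \<le> (\<Prod>i\<in>UNIV. C * (if i \<in> e then min 1 (2 ^ L k i * \<bar>h $ i\<bar>) ^ l else 1))"
    proof (intro prod_mono conjI)
      fix i
      show "0 \<le> (\<Sum>z\<in>{0..<2 ^ L k i}. \<phi> k i z)" by (intro sum_nonneg) (simp add: \<phi>_def)
      show "(\<Sum>z\<in>{0..<2 ^ L k i}. \<phi> k i z) \<le> C * (if i \<in> e then min 1 (2 ^ L k i * \<bar>h $ i\<bar>) ^ l else 1)"
        using C(2)[of "h $ i" "L k i" "x $ i"] sum_bump_le_1[of l "L k i" "x $ i"] C(1)
        by (simp add: \<phi>_def)
    qed
    also have "\<dots> = C ^ CARD('d) * (\<Prod>i\<in>e. min 1 (2 ^ L k i * \<bar>h $ i\<bar>) ^ l)"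
      unfolding prod.distrib prod_if_mem by simp
    finally show "(\<Prod>i\<in>UNIV. \<Sum>z\<in>{0..<2 ^ L k i}. \<phi> k i z)
      \<le> C ^ CARD('d) * (\<Prod>i\<in>e. min 1 (2 ^ L k i * \<bar>h $ i\<bar>) ^ l)" .
  qed
  finally show ?thesis by (simp add: sum_distrib_left mult.assoc)
qed

text \<open>Directions outside e receive the argument 1, where their factor is the pure power of
  \<open>2 ^ L k i\<close> with exponent -\<alpha>. This makes the normalisation the same for every
  e.\<close>

definition scaled_sum :: "'d set \<Rightarrow> real ^ 'd \<Rightarrow> real" where
  "scaled_sum e t = (\<Sum>k\<in>K. \<Prod>i\<in>UNIV. decay \<alpha> l (2 ^ L k i * (if i \<in> e then t $ i else 1)))"

lemma scaled_sum_nonneg: "(\<And>i. 0 \<le> t $ i) \<Longrightarrow> 0 \<le> scaled_sum e t"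
  unfolding scaled_sum_def by (intro sum_nonneg prod_nonneg decay_nonneg) auto

lemma scaled_sum_le:
  assumes "\<And>i. 0 \<le> t $ i"
  shows "scaled_sum e t \<le> B ^ CARD('d)"
proof (cases "\<exists>i\<in>e. t $ i = 0")
  case True
  then obtain i where i: "i \<in> e" "t $ i = 0" by blast
  have z: "(\<Prod>i\<in>UNIV. decay \<alpha> l (2 ^ L k i * (if i \<in> e then t $ i else 1))) = 0" for k
    using i
    by (intro prod_zero) (auto simp: decay_def intro!: exI[of _ i])
  have "scaled_sum e t = 0" unfolding scaled_sum_def z by simp
  then show ?thesis using B(1) by simp
next
  case False
  then show ?thesis
    unfolding scaled_sum_def using assms
    by (intro sum_prod_decay_le[OF \<alpha> _ B]) (auto simp: less_le)
qed

text \<open>Rescaling by \<open>2 ^ L k i\<close> costs the factor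
  \<open>2 powr (\<alpha> * real (L k i))\<close> in each direction. The levels add up to m, so all
  k share the prefactor \<open>2 powr (\<alpha> * real m)\<close>.\<close>

lemma weighted_modulus_eq:
  assumes t: "\<And>i. 0 \<le> t $ i"
  shows "(\<Prod>i\<in>e. (t $ i) powr (- \<alpha>)) * (\<Sum>k\<in>K. \<Prod>i\<in>e. min 1 (2 ^ L k i * t $ i) ^ l)
    = 2 powr (\<alpha> * real m) * scaled_sum e t"
proof -
  have "(\<Prod>i\<in>e. (t $ i) powr (- \<alpha>)) * (\<Prod>i\<in>e. min 1 (2 ^ L k i * t $ i) ^ l)
    = 2 powr (\<alpha> * real m) * (\<Prod>i\<in>UNIV. decay \<alpha> l (2 ^ L k i * (if i \<in> e then t $ i else 1)))"
    if k: "k \<in> K" for k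
  proof -
    have "\<alpha> * real m = (\<Sum>i\<in>UNIV. \<alpha> * real (L k i))"
      by (simp add: sum_lev[OF k Q(2)] flip: sum_distrib_left of_nat_sum)
    then have "2 powr (\<alpha> * real m) = (\<Prod>i\<in>UNIV. 2 powr (\<alpha> * real (L k i)))"
      by (simp add: powr_sum)
    then have "2 powr (\<alpha> * real m) * (\<Prod>i\<in>UNIV. decay \<alpha> l (2 ^ L k i * (if i \<in> e then t $ i else 1)))
      = (\<Prod>i\<in>UNIV. 2 powr (\<alpha> * real (L k i)) * decay \<alpha> l (2 ^ L k i * (if i \<in> e then t $ i else 1)))"
      by (simp add: prod.distrib)
    also have "\<dots> = (\<Prod>i\<in>UNIV. if i \<in> e then (t $ i) powr (- \<alpha>) * min 1 (2 ^ L k i * t $ i) ^ l else 1)"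
    proof (intro prod.cong refl)
      fix i
      have *: "2 powr (\<alpha> * real (L k i)) * (2 ^ L k i * s) powr (- \<alpha>) = s powr (- \<alpha>)" if "0 \<le> s" for s :: real
      proof -
        have "(2 ^ L k i * s) powr (- \<alpha>) = 2 powr (- (\<alpha> * real (L k i))) * s powr (- \<alpha>)"
          using that by (simp add: powr_mult powr_powr mult.commute flip: powr_realpow)
        then show ?thesis by (simp add: powr_minus)
      qed
      show "2 powr (\<alpha> * real (L k i)) * decay \<alpha> l (2 ^ L k i * (if i \<in> e then t $ i else 1))
        = (if i \<in> e then (t $ i) powr (- \<alpha>) * min 1 (2 ^ L k i * t $ i) ^ l else 1)"
        using *[of 1] *[OF t[of i]] unfolding decay_def mult.assoc[symmetric] by simp
    qed
    also have "\<dots> = (\<Prod>i\<in>e. (t $ i) powr (- \<alpha>) * min 1 (2 ^ L k i * t $ i) ^ l)"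
      by (rule prod_if_mem)
    finally show ?thesis by (simp add: prod.distrib)
  qed
  then show ?thesis unfolding scaled_sum_def sum_distrib_left by (intro sum.cong) auto
qed

lemma weighted_modulus_le:
  assumes p: "0 < p" and t: "\<And>i. 0 \<le> t $ i"
  shows "ennreal (\<Prod>i\<in>e. (t $ i) powr (- \<alpha>)) * mixed_modulus p l e fool t
    \<le> ennreal (A * C ^ CARD('d) * 2 powr (\<alpha> * real m) * scaled_sum e t)"
proof -
  have "mixed_modulus p l e fool t \<le> ennreal (A * C ^ CARD('d) * (\<Sum>k\<in>K. \<Prod>i\<in>e. min 1 (2 ^ L k i * t $ i) ^ l))"
    unfolding mixed_modulus_def
  proof (rule SUP_least)
    fix h :: "real ^ 'd" assume h: "h \<in> {h. \<forall>i\<in>e. \<bar>h $ i\<bar> < t $ i}"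
    have "Lp_norm p (mixed_diff l e h fool) \<le> ennreal (A * C ^ CARD('d) * (\<Sum>k\<in>K. \<Prod>i\<in>e. min 1 (2 ^ L k i * \<bar>h $ i\<bar>) ^ l))"
      using p mixed_diff_fool_le by (intro Lp_norm_le_sup continuous_mixed_diff continuous_fool)
    also have "\<dots> \<le> ennreal (A * C ^ CARD('d) * (\<Sum>k\<in>K. \<Prod>i\<in>e. min 1 (2 ^ L k i * t $ i) ^ l))"
      using h A C(1)
      by (intro ennreal_leI mult_left_mono sum_mono prod_mono conjI power_mono min.mono) (auto simp: less_imp_le)
    finally show "Lp_norm p (mixed_diff l e h fool)
      \<le> ennreal (A * C ^ CARD('d) * (\<Sum>k\<in>K. \<Prod>i\<in>e. min 1 (2 ^ L k i * t $ i) ^ l))" .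
  qed
  then have "ennreal (\<Prod>i\<in>e. (t $ i) powr (- \<alpha>)) * mixed_modulus p l e fool t
    \<le> ennreal (\<Prod>i\<in>e. (t $ i) powr (- \<alpha>)) * ennreal (A * C ^ CARD('d) * (\<Sum>k\<in>K. \<Prod>i\<in>e. min 1 (2 ^ L k i * t $ i) ^ l))"
    by (rule mult_left_mono) simp
  also have "\<dots> = ennreal (A * C ^ CARD('d) * ((\<Prod>i\<in>e. (t $ i) powr (- \<alpha>)) * (\<Sum>k\<in>K. \<Prod>i\<in>e. min 1 (2 ^ L k i * t $ i) ^ l)))"
    by (subst ennreal_mult'[symmetric]) (auto simp: prod_nonneg mult_ac)
  also have "\<dots> = ennreal (A * C ^ CARD('d) * 2 powr (\<alpha> * real m) * scaled_sum e t)"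
    unfolding weighted_modulus_eq[OF t] by (simp add: mult_ac)
  finally show ?thesis .
qed

lemma Lp_norm_fool_le:
  assumes "0 < p"
  shows "Lp_norm p fool \<le> ennreal (A * C ^ CARD('d) * 2 powr (\<alpha> * real m) * B ^ CARD('d))"
proof (rule Lp_norm_le_sup[OF assms continuous_fool])
  fix x
  have "\<bar>fool x\<bar> \<le> A * C ^ CARD('d) * (\<Sum>k\<in>K. 1)"
    using mixed_diff_fool_le[of "{}" 0 x] by (simp add: mixed_diff_empty)
  \<comment> \<open>For e empty the identity expresses the number of levels through the scaled sum,
    so the uniform bound on the latter also controls the plain norm.\<close>
  also have "(\<Sum>k\<in>K. 1) = 2 powr (\<alpha> * real m) * scaled_sum {} 1"
    using weighted_modulus_eq[of 1 "{}"] by simp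
  also have "A * C ^ CARD('d) * \<dots> \<le> A * C ^ CARD('d) * (2 powr (\<alpha> * real m) * B ^ CARD('d))"
    using A C(1) by (intro mult_left_mono scaled_sum_le) auto
  finally show "\<bar>fool x\<bar> \<le> A * C ^ CARD('d) * 2 powr (\<alpha> * real m) * B ^ CARD('d)"
    by (simp add: mult.assoc)
qed

text \<open>Split the power q into q - r and r. The first part is bounded uniformly in t; the second
  distributes over the levels, either because r = 1 or because there is only one level. Factors
  outside e are at most 1.\<close>

lemma scaled_sum_powr_le:
  assumes r: "0 < r" "r \<le> q" "r = 1 \<or> Q = 1" and t: "\<And>i. 0 \<le> t $ i"
  shows "scaled_sum e t powr q
    \<le> (B ^ CARD('d)) powr (q - r) * (\<Sum>k\<in>K. \<Prod>i\<in>e. decay \<alpha> l (2 ^ L k i * t $ i) powr r)"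
proof -
  define a where "a k = (\<Prod>i\<in>UNIV. decay \<alpha> l (2 ^ L k i * (if i \<in> e then t $ i else 1)))" for k
  have a0: "0 \<le> a k" for k unfolding a_def using t by (intro prod_nonneg decay_nonneg) auto
  have S: "scaled_sum e t = (\<Sum>k\<in>K. a k)" by (simp add: scaled_sum_def a_def)
  have "scaled_sum e t powr q = scaled_sum e t powr (q - r) * scaled_sum e t powr r"
    by (simp flip: powr_add)
  also have "\<dots> \<le> (B ^ CARD('d)) powr (q - r) * scaled_sum e t powr r"
    using r t by (intro mult_right_mono powr_mono2 scaled_sum_le scaled_sum_nonneg) auto
  also have "scaled_sum e t powr r = (\<Sum>k\<in>K. a k powr r)"
    using r(3)
  proof
    assume "r = 1"
    then show ?thesis by (simp add: S a0 sum_nonneg)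
  next
    assume "Q = 1"
    then have "card K = 1" by (simp add: card_levels)
    then obtain k where "K = {k}" by (rule card_1_singletonE)
    then show ?thesis by (simp add: S)
  qed
  also have "(\<Sum>k\<in>K. a k powr r) \<le> (\<Sum>k\<in>K. \<Prod>i\<in>e. decay \<alpha> l (2 ^ L k i * t $ i) powr r)"
  proof (rule sum_mono)
    fix k
    have "a k powr r = (\<Prod>i\<in>UNIV. decay \<alpha> l (2 ^ L k i * (if i \<in> e then t $ i else 1)) powr r)"
      unfolding a_def by (rule prod_powr_distrib)
    also have "\<dots> \<le> (\<Prod>i\<in>UNIV. if i \<in> e then decay \<alpha> l (2 ^ L k i * t $ i) powr r else 1)"
    proof (intro prod_mono conjI)
      fix i
      have "decay \<alpha> l (2 ^ L k i) powr r \<le> 1 powr r"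
        using r by (intro powr_mono2 decay_nonneg decay_le_1[OF \<alpha>]) auto
      then show "decay \<alpha> l (2 ^ L k i * (if i \<in> e then t $ i else 1)) powr r
        \<le> (if i \<in> e then decay \<alpha> l (2 ^ L k i * t $ i) powr r else 1)" by simp
    qed auto
    also have "\<dots> = (\<Prod>i\<in>e. decay \<alpha> l (2 ^ L k i * t $ i) powr r)"
      by (rule prod_if_mem)
    finally show "a k powr r \<le> (\<Prod>i\<in>e. decay \<alpha> l (2 ^ L k i * t $ i) powr r)" .
  qed
  finally show ?thesis by (simp add: mult_left_mono)
qed

text \<open>For finite \<theta> and nonempty e, integrating the split power gives one bounded
  integral per level, and the root turns their number into
  \<open>real (card K) powr enn2real (1 / \<theta>)\<close>. The other cases need only the uniform
  bound.\<close>

lemma besov_seminorm_fool_le: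
  assumes p: "0 < p" and \<theta>: "0 < \<theta>"
    and r: "0 < r" "\<theta> \<noteq> top \<Longrightarrow> r \<le> enn2real \<theta>" "r = 1 \<or> Q = 1"
    and D: "1 \<le> D" "\<And>\<kappa>. 0 < \<kappa> \<Longrightarrow>
      (\<integral>\<^sup>+t. ennreal (indicator {0..1} t * (decay \<alpha> l (\<kappa> * t) powr r * inverse t)) \<partial>lborel) \<le> ennreal D"
  shows "besov_seminorm p \<theta> \<alpha> l e fool \<le> ennreal (A * 2 powr (\<alpha> * real m) * real (card K) powr enn2real (1 / \<theta>)
      * (C ^ CARD('d) * B ^ CARD('d) * (D ^ CARD('d)) powr enn2real (1 / \<theta>)))"
proof -
  define A' where "A' = A * C ^ CARD('d) * 2 powr (\<alpha> * real m)"
  have A': "0 \<le> A'" using A C(1) by (simp add: A'_def)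
  have B1: "1 \<le> B ^ CARD('d)" using B(1) by simp
  have D1: "1 \<le> D ^ CARD('d)" using D(1) by simp
  define R where "R = A' * B ^ CARD('d) * (real (card K) powr enn2real (1 / \<theta>) * (D ^ CARD('d)) powr enn2real (1 / \<theta>))"
  \<comment> \<open>The remaining factors of R are at least 1, so R also covers the empty e and
    \<theta> = \<infinity>.\<close>
  have R: "A' * B ^ CARD('d) \<le> R"
  proof -
    have "1 * 1 \<le> real (card K) powr enn2real (1 / \<theta>) * (D ^ CARD('d)) powr enn2real (1 / \<theta>)"
      using card_K_pos D1 by (intro mult_mono ge_one_powr_ge_zero) auto
    from mult_left_mono[OF this, of "A' * B ^ CARD('d)"] show ?thesis
      using A' B1 by (simp add: R_def)
  qed
  have "besov_seminorm p \<theta> \<alpha> l e fool \<le> ennreal R"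
  proof (cases "e = {}")
    case True
    then have "besov_seminorm p \<theta> \<alpha> l e fool = Lp_norm p fool" by (simp add: besov_seminorm_def)
    also have "\<dots> \<le> ennreal (A' * B ^ CARD('d))" unfolding A'_def by (rule Lp_norm_fool_le[OF p])
    also have "\<dots> \<le> ennreal R" by (rule ennreal_leI[OF R])
    finally show ?thesis .
  next
    case e: False
    show ?thesis
    proof (cases "\<theta> = top")
      case True
      have "ennreal (\<Prod>i\<in>e. (t $ i) powr (- \<alpha>)) * mixed_modulus p l e fool t \<le> ennreal R"
        if "t \<in> cbox 0 1" for t :: "real ^ 'd"
      proof -
        have t: "0 \<le> t $ i" for i using that by (simp add: mem_box_cart)
        have "A' * scaled_sum e t \<le> R"
          using A' R mult_left_mono[OF scaled_sum_le[OF t, of e] A'] by linarith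
        then show ?thesis
          using weighted_modulus_le[OF p t, of e] unfolding A'_def[symmetric]
          by (meson ennreal_leI order_trans)
      qed
      then show ?thesis using e True by (auto simp: besov_seminorm_def intro!: SUP_least)
    next
      case False
      define q where "q = enn2real \<theta>"
      have q: "0 < q" using False \<theta> by (simp add: q_def enn2real_positive_iff less_top)
      have q': "enn2real (1 / \<theta>) = 1 / q"
      proof -
        have "\<theta> = ennreal q" using False by (simp add: q_def less_top)
        then have "1 / \<theta> = ennreal (1 / q)" using divide_ennreal[of 1 q] q by simp
        then show ?thesis using q by simp
      qed
      have rq: "r \<le> q" using r(2) False by (simp add: q_def)
      define X where "X = A' powr q * (B ^ CARD('d)) powr (q - r)"
      have X: "0 \<le> X" by (simp add: X_def)
      have "(\<integral>\<^sup>+t\<in>cbox 0 1.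
          ennreal_powr (ennreal (\<Prod>i\<in>e. (t $ i) powr (-\<alpha>)) * mixed_modulus p l e fool t) q
            * ennreal (\<Prod>i\<in>e. inverse (t $ i)) \<partial>lborel)
        \<le> (\<integral>\<^sup>+t. (\<Sum>k\<in>K. ennreal X * (ennreal (\<Prod>i\<in>e. decay \<alpha> l (2 ^ L k i * t $ i) powr r * inverse (t $ i)) * indicator (cbox 0 1) t)) \<partial>lborel)"
      proof (rule nn_integral_mono)
        fix t :: "real ^ 'd"
        show "ennreal_powr (ennreal (\<Prod>i\<in>e. (t $ i) powr (-\<alpha>)) * mixed_modulus p l e fool t) q
            * ennreal (\<Prod>i\<in>e. inverse (t $ i)) * indicator (cbox 0 1) t
          \<le> (\<Sum>k\<in>K. ennreal X * (ennreal (\<Prod>i\<in>e. decay \<alpha> l (2 ^ L k i * t $ i) powr r * inverse (t $ i)) * indicator (cbox 0 1) t))"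
        proof (cases "t \<in> cbox 0 1")
          case True
          then have t: "0 \<le> t $ i" for i by (simp add: mem_box_cart)
          define P where "P = (\<Prod>i\<in>e. inverse (t $ i))"
          have P: "0 \<le> P" using t by (simp add: P_def prod_nonneg)
          have "ennreal_powr (ennreal (\<Prod>i\<in>e. (t $ i) powr (-\<alpha>)) * mixed_modulus p l e fool t) q * ennreal P
            \<le> ennreal_powr (ennreal (A' * scaled_sum e t)) q * ennreal P"
            unfolding A'_def using q by (intro mult_right_mono ennreal_powr_mono weighted_modulus_le p t) auto
          also have "\<dots> = ennreal ((A' * scaled_sum e t) powr q * P)"
            using mult_nonneg_nonneg[OF A' scaled_sum_nonneg[OF t, of e]] P
            by (simp only: ennreal_powr_ennreal) (simp add: ennreal_mult')
          also have "\<dots> \<le> ennreal (\<Sum>k\<in>K. X * (\<Prod>i\<in>e. decay \<alpha> l (2 ^ L k i * t $ i) powr r * inverse (t $ i)))"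
          proof (rule ennreal_leI)
            have "(A' * scaled_sum e t) powr q * P = A' powr q * scaled_sum e t powr q * P"
              using A' scaled_sum_nonneg[OF t] by (simp add: powr_mult)
            also have "\<dots> \<le> A' powr q * ((B ^ CARD('d)) powr (q - r) * (\<Sum>k\<in>K. \<Prod>i\<in>e. decay \<alpha> l (2 ^ L k i * t $ i) powr r)) * P"
              using P by (intro mult_right_mono mult_left_mono scaled_sum_powr_le r(1,3) rq t) auto
            also have "\<dots> = (\<Sum>k\<in>K. X * (\<Prod>i\<in>e. decay \<alpha> l (2 ^ L k i * t $ i) powr r * inverse (t $ i)))"
              by (simp add: X_def P_def sum_distrib_left sum_distrib_right prod.distrib mult_ac)
            finally show "(A' * scaled_sum e t) powr q * P \<le> \<dots>" .
          qed
          also have "\<dots> = (\<Sum>k\<in>K. ennreal (X * (\<Prod>i\<in>e. decay \<alpha> l (2 ^ L k i * t $ i) powr r * inverse (t $ i))))"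
            using X t by (intro sum_ennreal[symmetric] mult_nonneg_nonneg prod_nonneg) auto
          finally show ?thesis using True X by (simp add: P_def ennreal_mult')
        qed simp
      qed
      also have "\<dots> = (\<Sum>k\<in>K. ennreal X * (\<integral>\<^sup>+t\<in>cbox 0 1. ennreal (\<Prod>i\<in>e. decay \<alpha> l (2 ^ L k i * t $ i) powr r * inverse (t $ i)) \<partial>lborel))"
      proof -
        have [measurable]: "(\<lambda>t::real ^ 'd. ennreal (\<Prod>i\<in>e. decay \<alpha> l (2 ^ L k i * t $ i) powr r * inverse (t $ i)) * indicator (cbox 0 1) t) \<in> borel_measurable lborel" for k
          unfolding decay_def by measurable
        show ?thesis by (simp add: nn_integral_sum nn_integral_cmult)
      qed
      also have "\<dots> \<le> (\<Sum>k\<in>K. ennreal X * ennreal (D ^ CARD('d)))"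
        by (intro sum_mono mult_left_mono nn_integral_prod_decay_le D) auto
      also have "\<dots> = ennreal (real (card K) * (X * D ^ CARD('d)))"
        using X D1 by (simp add: ennreal_mult' ennreal_of_nat_eq_real_of_nat)
      finally have "besov_seminorm p \<theta> \<alpha> l e fool \<le> ennreal_powr (ennreal (real (card K) * (X * D ^ CARD('d)))) (1 / q)"
        using e False q unfolding besov_seminorm_def q_def[symmetric] by (auto intro!: ennreal_powr_mono)
      also have "\<dots> = ennreal ((real (card K) * (X * D ^ CARD('d))) powr (1 / q))"
        using X D1 by (intro ennreal_powr_ennreal) auto
      also have "\<dots> \<le> ennreal R"
      proof (rule ennreal_leI)
        have "(real (card K) * (X * D ^ CARD('d))) powr (1 / q)
          = A' * (B ^ CARD('d)) powr ((q - r) / q) * (real (card K) powr (1 / q) * (D ^ CARD('d)) powr (1 / q))"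
          using A' q B1 D1 by (simp add: X_def powr_mult powr_powr)
        \<comment> \<open>The exponent (q - r)/q is at most 1 and the base at least 1, so r
          disappears from the power of B.\<close>
        also have "\<dots> \<le> A' * (B ^ CARD('d)) powr 1 * (real (card K) powr (1 / q) * (D ^ CARD('d)) powr (1 / q))"
          using A' q r(1) B1 by (intro mult_right_mono mult_left_mono powr_mono) (auto simp: field_simps)
        finally show "(real (card K) * (X * D ^ CARD('d))) powr (1 / q) \<le> R"
          using B1 by (simp add: R_def q')
      qed
      finally show ?thesis .
    qed
  qed
  then show ?thesis by (simp add: R_def A'_def mult_ac)
qed

end

subsection \<open>Lower bound for the integral\<close>

context fooling
begin

text \<open>The middle half of a box in every direction, where \<open>bump_lower_bound\<close>
  applies to all factors.\<close>

definition core :: "('d \<Rightarrow> nat) \<Rightarrow> ('d \<Rightarrow> int) \<Rightarrow> (real ^ 'd) set" where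
  "core k j = cbox (\<chi> i. (real_of_int (j i) + 1 / 4) / 2 ^ L k i) (\<chi> i. (real_of_int (j i) + 3 / 4) / 2 ^ L k i)"

lemma measure_core:
  assumes "k \<in> K"
  shows "measure lborel (core k j) = (1 / 2) ^ CARD('d) / 2 ^ m"
proof -
  have "core k j \<noteq> {}"
    unfolding core_def interval_ne_empty_cart by (auto intro!: divide_right_mono)
  then have "measure lborel (core k j) = (\<Prod>i\<in>UNIV. (1 / 2) / 2 ^ L k i)"
    unfolding core_def by (subst content_cbox_cart) (auto intro!: prod.cong simp: field_simps)
  also have "\<dots> = (1 / 2) ^ CARD('d) / 2 ^ (\<Sum>i\<in>UNIV. L k i)"
    by (simp add: prod_dividef prod.distrib power_one_over power_sum)
  finally show ?thesis by (simp add: sum_lev[OF assms Q(2)])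
qed

lemma core_subset:
  assumes "j \<in> boxes k"
  shows "core k j \<subseteq> cbox 0 1"
proof
  fix y assume y: "y \<in> core k j"
  have bounds: "0 \<le> (real_of_int (j i) + 1 / 4) / 2 ^ L k i \<and> (real_of_int (j i) + 3 / 4) / 2 ^ L k i \<le> 1" for i
  proof -
    have "j i \<in> {0..<2 ^ L k i}" using assms by (rule PiE_mem) simp
    then have "0 \<le> j i" "j i + 1 \<le> 2 ^ L k i" by auto
    then have "0 \<le> real_of_int (j i)" "real_of_int (j i + 1) \<le> real_of_int (2 ^ L k i)"
      by (simp_all only: of_int_le_iff of_int_0_le_iff)
    then show ?thesis by (simp add: divide_le_eq)
  qed
  show "y \<in> cbox 0 1"
    unfolding mem_box_cart zero_index one_index
  proof
    fix i
    have "(real_of_int (j i) + 1 / 4) / 2 ^ L k i \<le> y $ i" "y $ i \<le> (real_of_int (j i) + 3 / 4) / 2 ^ L k i"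
      using y by (simp_all add: core_def mem_box_cart)
    with bounds[of i] show "0 \<le> y $ i \<and> y $ i \<le> 1" by linarith
  qed
qed

text \<open>Each tensor bump is at least \<open>(1 / 2) ^ ((l + 1) * CARD('d))\<close> on its core,
  a core has volume \<open>(1 / 2) ^ CARD('d) / 2 ^ m\<close>, and each level has at least
  \<open>2 ^ m / 2\<close> boxes; this last 1/2 gives the extra 1 in the exponent. The comparison is
  made term by term, so cores of different levels may overlap.\<close>

lemma integral_fool_ge:
  assumes N: "\<And>k. k \<in> K \<Longrightarrow> 2 ^ m / 2 \<le> real (card (J k))"
  shows "A * real (card K) * ((1 / 2) ^ ((l + 1) * CARD('d)) * (1 / 2) ^ (CARD('d) + 1))
    \<le> (LINT y:cbox 0 1|lborel. fool y)"
proof -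
  define c :: real where "c = (1 / 2) ^ ((l + 1) * CARD('d))"
  define G where "G y = (\<Sum>k\<in>K. \<Sum>j\<in>J k. A * c * indicator (core k j) y)" for y
  have int: "integrable lborel (\<lambda>y. A * c * indicator (core k j) y)" for k j
    by (intro integrable_mult_right integrable_real_indicator) (auto simp: core_def emeasure_lborel_cbox_eq)
  have "A * real (card K) * (c * (1 / 2) ^ (CARD('d) + 1))
    = (\<Sum>k\<in>K. A * c * ((1 / 2) ^ CARD('d) / 2 ^ m) * (2 ^ m / 2))"
    by simp
  also have "\<dots> \<le> (\<Sum>k\<in>K. A * c * ((1 / 2) ^ CARD('d) / 2 ^ m) * real (card (J k)))"
    using A by (intro sum_mono mult_left_mono N) (auto simp: c_def)
  also have "\<dots> = (\<Sum>k\<in>K. \<Sum>j\<in>J k. A * c * measure lborel (core k j))"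
    by (intro sum.cong refl) (simp add: measure_core)
  also have "\<dots> = integral\<^sup>L lborel G"
  proof -
    have "integral\<^sup>L lborel (\<lambda>y. A * c * indicator (core k j) y) = A * c * measure lborel (core k j)" for k j
      by (subst integral_mult_right_zero) simp
    then show ?thesis
      unfolding G_def using int by (simp add: Bochner_Integration.integral_sum)
  qed
  also have "\<dots> \<le> (LINT y:cbox 0 1|lborel. fool y)"
    unfolding set_lebesgue_integral_def
  proof (rule integral_mono)
    show "integrable lborel G" unfolding G_def using int by (intro Bochner_Integration.integrable_sum)
    show "integrable lborel (\<lambda>y. indicator (cbox 0 1) y *\<^sub>R fool y)"
      by (rule borel_integrable_compact) (auto intro: continuous_on_subset[OF continuous_fool])
    fix y :: "real ^ 'd"
    have term_le: "A * c * indicator (core k j) y \<le> A * (\<Prod>i\<in>UNIV. bump l (L k i) (j i) (y $ i))"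
      if "k \<in> K" "j \<in> J k" for k j
    proof (cases "y \<in> core k j")
      case True
      have "c = (\<Prod>i\<in>(UNIV :: 'd set). (1 / 2) ^ (l + 1))" unfolding c_def power_mult by simp
      also have "\<dots> \<le> (\<Prod>i\<in>UNIV. bump l (L k i) (j i) (y $ i))"
        using True J[OF that(1)] that(2)
        by (intro prod_mono conjI bump_lower_bound) (auto simp: core_def mem_box_cart PiE_iff)
      finally show ?thesis using True A by (simp add: mult_left_mono)
    qed (use A in \<open>auto intro!: mult_nonneg_nonneg prod_nonneg simp: bump_nonneg\<close>)
    show "G y \<le> indicator (cbox 0 1) y *\<^sub>R fool y"
    proof (cases "y \<in> cbox 0 1")
      case True
      then show ?thesis unfolding G_def fool_def using term_le by (simp add: sum_mono)
    next
      case False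
      then have "y \<notin> core k j" if "k \<in> K" "j \<in> J k" for k j
        using core_subset J that by blast
      then have "G y = 0" unfolding G_def by (intro sum.neutral ballI) auto
      then show ?thesis using False by simp
    qed
  qed
  finally show ?thesis by (simp only: c_def)
qed

text \<open>Cells are half-open, so on each level a single box contains y, and only the bump of that
  box could be nonzero there.\<close>

lemma fool_eq_0:
  assumes "\<And>k. k \<in> K \<Longrightarrow> (\<lambda>i. cell (L k i) (y $ i)) \<notin> J k"
  shows "fool y = 0"
  unfolding fool_def
proof (intro sum.neutral ballI)
  fix k j assume "k \<in> K" "j \<in> J k"
  with assms have "j \<noteq> (\<lambda>i. cell (L k i) (y $ i))" by blast
  then obtain i where "j i \<noteq> cell (L k i) (y $ i)" by (auto simp: fun_eq_iff)
  then have "bump l (L k i) (j i) (y $ i) = 0" by (intro bump_eq_0) auto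
  then have "(\<Prod>i\<in>UNIV. bump l (L k i) (j i) (y $ i)) = 0" by (intro prod_zero) auto
  then show "A * (\<Prod>i\<in>UNIV. bump l (L k i) (j i) (y $ i)) = 0" by simp
qed

text \<open>The norm has one summand for each of the \<open>2 ^ CARD('d)\<close> sets e, so it
  suffices that each is at most the reciprocal of this number. The function is continuous and
  represents itself.\<close>

lemma fool_in_ball:
  assumes p: "0 < p" and \<theta>: "0 < \<theta>"
    and r: "0 < r" "\<theta> \<noteq> top \<Longrightarrow> r \<le> enn2real \<theta>" "r = 1 \<or> Q = 1"
    and D: "1 \<le> D" "\<And>\<kappa>. 0 < \<kappa> \<Longrightarrow>
      (\<integral>\<^sup>+t. ennreal (indicator {0..1} t * (decay \<alpha> l (\<kappa> * t) powr r * inverse t)) \<partial>lborel) \<le> ennreal D"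
    and le: "A * 2 powr (\<alpha> * real m) * real (card K) powr enn2real (1 / \<theta>)
      * (C ^ CARD('d) * B ^ CARD('d) * (D ^ CARD('d)) powr enn2real (1 / \<theta>)) \<le> 1 / 2 ^ CARD('d)"
  shows "fool \<in> continuous_reps (besov_ball p \<theta> \<alpha> l)"
proof -
  have "besov_norm p \<theta> \<alpha> l fool \<le> (\<Sum>e\<in>(UNIV :: 'd set set). ennreal (1 / 2 ^ CARD('d)))"
    unfolding besov_norm_def
    by (intro sum_mono order_trans[OF besov_seminorm_fool_le[OF p \<theta> r D] ennreal_leI[OF le]])
  also have "\<dots> = ennreal (\<Sum>e\<in>(UNIV :: 'd set set). 1 / 2 ^ CARD('d))"
    by (rule sum_ennreal) simp
  also have "\<dots> = 1" by (simp add: card_UNIV_set)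
  finally have n1: "besov_norm p \<theta> \<alpha> l fool \<le> 1" .
  then have "besov_norm p \<theta> \<alpha> l fool < top" by (rule le_less_trans) simp
  moreover have "Lp_norm p fool < top"
    using Lp_norm_fool_le[OF p] by (rule le_less_trans) simp
  ultimately have "fool \<in> besov_ball p \<theta> \<alpha> l"
    using n1 continuous_fool periodic_fool
    by (auto simp: besov_ball_def besov_space_def intro: borel_measurable_continuous_onI)
  then show ?thesis
    using continuous_fool by (auto simp: continuous_reps_def)
qed

end

section \<open>Choice of parameters and conclusion\<close>

text \<open>Positivity of y settles the convention 0^0 = 1: for s = 0 the right side is 1. This
  occurs at n = 1, where the logarithm is 0.\<close>

lemma powr_conv_le_powr:
  assumes "0 \<le> x" "x \<le> y" "0 < y" "0 \<le> s"
  shows "powr_conv x s \<le> y powr s"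
  using assms by (auto simp: powr_conv_def intro: powr_mono2)

text \<open>Take the least q satisfying the first inequality; minimality yields the second. The
  exponent is a multiple of d so that q values per free coordinate fit into the total level m = d
  q.\<close>

lemma dyadic_size_exists:
  assumes "0 < d" and "1 \<le> n"
  shows "\<exists>q\<ge>1. 2 * n \<le> 2 ^ (d * q) \<and> 2 ^ (d * q) \<le> 2 ^ (d + 1) * (n :: nat)"
proof -
  define q where "q = (LEAST q. 2 * n \<le> 2 ^ (d * q))"
  have "2 * n \<le> 2 ^ (d * (2 * n))"
  proof -
    have "2 * n \<le> 2 ^ (2 * n)" by (rule less_imp_le) (rule less_exp)
    also have "\<dots> \<le> 2 ^ (d * (2 * n))" using assms(1) by (intro power_increasing) auto
    finally show ?thesis .
  qed
  then have q: "2 * n \<le> 2 ^ (d * q)" unfolding q_def by (rule LeastI)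
  then have "q \<noteq> 0" using assms(2) by (intro notI) simp
  then have "\<not> 2 * n \<le> 2 ^ (d * (q - 1))" using not_less_Least[of "q - 1" "\<lambda>q. 2 * n \<le> 2 ^ (d * q)"]
    unfolding q_def by simp
  then have "2 ^ d * 2 ^ (d * (q - 1)) \<le> 2 ^ d * (2 * n)" by (intro mult_left_mono) auto
  moreover have "d * q = d + d * (q - 1)" using \<open>q \<noteq> 0\<close> by (cases q) auto
  ultimately show ?thesis using q \<open>q \<noteq> 0\<close>
    by (intro exI[of _ q]) (simp add: power_add)
qed

lemma enn2real_inverse_cases:
  assumes "0 < \<theta>"
  shows "\<theta> \<le> 1 \<Longrightarrow> 1 \<le> enn2real (1 / \<theta>)" and "\<not> \<theta> \<le> 1 \<Longrightarrow> enn2real (1 / \<theta>) \<le> 1"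
proof -
  have *: "\<theta> = ennreal t \<Longrightarrow> 0 \<le> t \<Longrightarrow> enn2real (1 / \<theta>) = 1 / t" for t
    using divide_ennreal[of 1 t] assms by (simp add: ennreal_less_zero_iff less_le)
  show "1 \<le> enn2real (1 / \<theta>)" if "\<theta> \<le> 1"
    using * that assms by (cases \<theta>) (auto simp: ennreal_less_zero_iff ennreal_le_1 top.extremum_unique)
  show "enn2real (1 / \<theta>) \<le> 1" if "\<not> \<theta> \<le> 1"
    using * that by (cases \<theta>) (auto simp: ennreal_le_1)
qed

theorem theorem4p1:
  fixes p \<theta> :: ennreal and \<alpha> :: real and l :: nat
  assumes "0 < p" and "0 < \<theta>" and "1 / p < ennreal \<alpha>" and "\<alpha> < real l"
  shows "\<exists>c>0. \<forall>n\<ge>1.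
    cubature_error n (continuous_reps (besov_ball p \<theta> \<alpha> l :: (real ^ 'd \<Rightarrow> real) set))
      \<ge> ennreal (c * real n powr (-\<alpha>)
           * powr_conv (ln (real n)) ((real CARD('d) - 1) * max 0 (1 - enn2real (1 / \<theta>))))"
proof -
  have \<alpha>: "0 < \<alpha>" using assms(3) by (metis ennreal_less_zero_iff le_less_trans zero_le)
  define d where "d = CARD('d)"
  have d: "0 < d" "1 \<le> d" by (auto simp: d_def Suc_le_eq)
  define \<iota> where "\<iota> = enn2real (1 / \<theta>)"
  have \<iota>0: "0 \<le> \<iota>" by (simp add: \<iota>_def)
  define s where "s = (real d - 1) * max 0 (1 - \<iota>)"
  have s0: "0 \<le> s" using d by (simp add: s_def)
  \<comment> \<open>For \<theta> \<le> 1 the whole power \<theta> is integrated on a single level;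
    for \<theta> > 1 one power is integrated and the rest is bounded uniformly.\<close>
  define r where "r = (if \<theta> \<le> 1 then enn2real \<theta> else 1)"
  have r: "0 < r" "\<theta> \<noteq> top \<Longrightarrow> r \<le> enn2real \<theta>"
  proof -
    show "0 < r" using assms(2) by (auto simp: r_def enn2real_positive_iff intro: le_less_trans)
    show "r \<le> enn2real \<theta>" if "\<theta> \<noteq> top"
      using that by (cases \<theta>) (auto simp: r_def ennreal_le_1)
  qed
  obtain C where C: "1 \<le> C" "\<And>k s x. (\<Sum>j\<in>{0..<2 ^ k}. \<bar>fdiff l s (bump l k j) x\<bar>) \<le> C * min 1 (2 ^ k * \<bar>s\<bar>) ^ l"
    using sum_fdiff_bump_bound by blast
  obtain B where B: "1 \<le> B" "\<And>u Q. 0 < u \<Longrightarrow> (\<Sum>j<Q. decay \<alpha> l (2 ^ j * u)) \<le> B"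
    using sum_decay_bounded[OF \<alpha> assms(4)] by blast
  obtain D where D: "1 \<le> D" "\<And>\<kappa>. 0 < \<kappa> \<Longrightarrow>
      (\<integral>\<^sup>+t. ennreal (indicator {0..1} t * (decay \<alpha> l (\<kappa> * t) powr r * inverse t)) \<partial>lborel) \<le> ennreal D"
    using nn_integral_decay_bounded[OF \<alpha> assms(4) r(1)] by blast
  define M where "M = C ^ d * B ^ d * (D ^ d) powr \<iota>"
  have M: "0 < M" using C(1) B(1) D(1) by (simp add: M_def)
  \<comment> \<open>This normalisation makes every seminorm at most
    \<open>1 / 2 ^ d\<close>.\<close>
  define c0 where "c0 = 1 / (2 ^ d * M)"
  have c0: "0 < c0" using M by (simp add: c0_def)
  define c1 :: real where "c1 = (1 / 2) ^ ((l + 1) * d) * (1 / 2) ^ (d + 1)"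
  have c1: "0 < c1" by (simp add: c1_def)
  \<comment> \<open>The last two factors pay for replacing \<open>2 ^ m\<close> by its upper bound
    \<open>2 ^ (d + 1) * n\<close> and ln n by its upper bound d q.\<close>
  define c where "c = c0 * c1 * (2 ^ (d + 1)) powr (- \<alpha>) * real d powr (- s)"
  have c: "0 < c" using c0 c1 d by (simp add: c_def)
  have "ennreal (c * real n powr (-\<alpha>) * powr_conv (ln (real n)) s)
    \<le> cubature_error n (continuous_reps (besov_ball p \<theta> \<alpha> l :: (real ^ 'd \<Rightarrow> real) set))" if n: "1 \<le> n" for n
  proof -
    obtain q where q: "1 \<le> q" "2 * n \<le> 2 ^ (d * q)" "2 ^ (d * q) \<le> 2 ^ (d + 1) * n"
      using dyadic_size_exists[OF d(1) n] by blast
    define m where "m = d * q"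
    define Q where "Q = (if \<theta> \<le> 1 then 1 else q)"
    have QQ: "1 \<le> Q" "d * (Q - 1) \<le> m" "r = 1 \<or> Q = 1" using q(1) by (auto simp: Q_def m_def r_def)
    define i0 :: 'd where "i0 = undefined"
    define Kc where "Kc = real (card (levels Q i0))"
    have Kc: "Kc = real Q ^ (d - 1)" by (simp add: Kc_def card_levels d_def)
    have Kc1: "1 \<le> Kc" using QQ(1) by (simp add: Kc)
    \<comment> \<open>The amplitude balances the factor from \<open>besov_seminorm_fool_le\<close>;
      the integral is then of order
      \<open>2 powr (- (\<alpha> * real m)) * Kc powr (1 - \<iota>)\<close>.\<close>
    define A where "A = c0 * 2 powr (- (\<alpha> * real m)) * Kc powr (- \<iota>)"
    have A: "0 \<le> A" using c0 by (simp add: A_def)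
    have final: "c * real n powr (-\<alpha>) * powr_conv (ln (real n)) s \<le> A * Kc * c1"
    proof -
      have "ln (real n) \<le> real d * real q"
      proof -
        have "n \<le> 2 ^ m" using q(2) by (simp add: m_def)
        then have "real n \<le> real (2 ^ m)" by (simp only: of_nat_le_iff)
        then have "ln (real n) \<le> ln (2 ^ m)" using n by (intro ln_mono) auto
        also have "\<dots> = real m * ln 2" by (simp add: ln_realpow)
        also have "\<dots> \<le> real m * 1" using ln_le_minus_one[of 2] by (intro mult_left_mono) auto
        finally show ?thesis by (simp add: m_def)
      qed
      then have "powr_conv (ln (real n)) s \<le> (real d * real q) powr s"
        using n d q(1) s0 by (intro powr_conv_le_powr) auto
      also have "\<dots> = real d powr s * real q powr s" by (simp add: powr_mult)
      \<comment> \<open>For \<theta> \<le> 1 both sides are 1, as s = 0 and Kc = 1. Otherwise Kc is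
        the power of q with exponent d - 1, and the maximum in s is 1 - \<iota>.\<close>
      also have "real q powr s = Kc powr (1 - \<iota>)"
      proof (cases "\<theta> \<le> 1")
        case True
        then show ?thesis
          using enn2real_inverse_cases(1)[OF assms(2)] q(1) by (simp add: s_def Kc Q_def \<iota>_def)
      next
        case False
        then have "\<iota> \<le> 1" using enn2real_inverse_cases(2)[OF assms(2)] by (simp add: \<iota>_def)
        then have "real q powr s = (real q powr real (d - 1)) powr (1 - \<iota>)"
          using d by (simp add: s_def powr_powr of_nat_diff)
        then show ?thesis using False q(1) by (simp add: Kc Q_def powr_realpow)
      qed
      finally have a: "powr_conv (ln (real n)) s \<le> real d powr s * Kc powr (1 - \<iota>)" .
      have b: "(2 ^ (d + 1)) powr (- \<alpha>) * real n powr (- \<alpha>) \<le> 2 powr (- (\<alpha> * real m))"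
      proof -
        have "real (2 ^ (d * q)) \<le> real (2 ^ (d + 1) * n)" using q(3) by (simp only: of_nat_le_iff)
        then have "(2 ^ (d + 1) * real n) powr (- \<alpha>) \<le> (2 ^ m) powr (- \<alpha>)"
          using \<alpha> by (intro powr_mono2') (auto simp: m_def)
        also have "(2 ^ m) powr (- \<alpha>) = 2 powr (- (\<alpha> * real m))"
          by (simp add: powr_powr mult.commute flip: powr_realpow)
        finally show ?thesis by (simp add: powr_mult)
      qed
      have "c * real n powr (-\<alpha>) * powr_conv (ln (real n)) s
        = (c0 * c1 * real d powr (- s)) * (((2 ^ (d + 1)) powr (- \<alpha>) * real n powr (- \<alpha>)) * powr_conv (ln (real n)) s)"
        by (simp add: c_def mult_ac)
      also have "\<dots> \<le> (c0 * c1 * real d powr (- s)) * (2 powr (- (\<alpha> * real m)) * (real d powr s * Kc powr (1 - \<iota>)))"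
        using c0 c1 n by (intro mult_left_mono mult_mono a b) (auto simp: powr_conv_def)
      also have "\<dots> = A * Kc * c1"
        using d Kc1 by (simp add: A_def powr_minus powr_diff field_simps)
      finally show ?thesis .
    qed
    show ?thesis
      unfolding cubature_error_def
    proof (rule INF_greatest, clarify)
      fix x :: "nat \<Rightarrow> real ^ 'd" and w :: "nat \<Rightarrow> real"
      \<comment> \<open>Keep exactly the boxes that contain no node, so the function vanishes at all
        nodes and the weights become irrelevant.\<close>
      define J where "J k = PiE UNIV (\<lambda>i. {0..<2 ^ lev m i0 k i}) - (\<lambda>t i. cell (lev m i0 k i) (x t $ i)) ` {..<n}" for k
      interpret fooling \<alpha> A C B l m Q i0 J
        by unfold_locales (use \<alpha> assms(4) A B C QQ in \<open>auto simp: J_def d_def\<close>)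
      have "fool \<in> continuous_reps (besov_ball p \<theta> \<alpha> l)"
      proof (rule fool_in_ball[OF assms(1,2) r QQ(3) D])
        have "A * 2 powr (\<alpha> * real m) * Kc powr \<iota> = c0"
          using Kc1 by (simp add: A_def powr_minus field_simps)
        then show "A * 2 powr (\<alpha> * real m) * real (card (levels Q i0)) powr enn2real (1 / \<theta>) *
          (C ^ CARD('d) * B ^ CARD('d) * (D ^ CARD('d)) powr enn2real (1 / \<theta>)) \<le> 1 / 2 ^ CARD('d)"
          using M by (simp add: c0_def M_def d_def flip: Kc_def \<iota>_def)
      qed
      moreover have "fool (x t) = 0" if "t < n" for t
        using that by (intro fool_eq_0) (auto simp: J_def)
      then have "(\<Sum>j<n. w j * fool (x j)) = 0" by simp
      moreover have "A * Kc * c1 \<le> (LINT y:cbox 0 1|lborel. fool y)"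
        unfolding Kc_def c1_def d_def
      proof (rule integral_fool_ge)
        fix k assume k: "k \<in> levels Q i0"
        \<comment> \<open>The n nodes occupy at most n of at least 2 n boxes, so at least half of
          the boxes remain free on every level.\<close>
        have "2 ^ m = card (boxes k)"
          by (simp add: card_PiE nat_power_eq sum_lev[OF k QQ(2)[unfolded d_def]] flip: power_sum)
        moreover have "card (boxes k) - card ((\<lambda>t i. cell (lev m i0 k i) (x t $ i)) ` {..<n}) \<le> card (J k)"
          unfolding J_def by (rule diff_card_le_card_Diff) simp
        moreover have "card ((\<lambda>t i. cell (lev m i0 k i) (x t $ i)) ` {..<n}) \<le> n"
          using card_image_le[of "{..<n}"] by simp
        ultimately have "2 ^ m \<le> 2 * card (J k)" using q(2) by (simp add: m_def)
        then have "real (2 ^ m) \<le> real (2 * card (J k))" by (simp only: of_nat_le_iff)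
        then show "2 ^ m / 2 \<le> real (card (J k))" by simp
      qed
      ultimately show "ennreal (c * real n powr (-\<alpha>) * powr_conv (ln (real n)) s)
        \<le> (SUP f\<in>continuous_reps (besov_ball p \<theta> \<alpha> l).
            ennreal \<bar>(LINT y:cbox 0 1|lborel. f y) - (\<Sum>j<n. w j * f (x j))\<bar>)"
        using final by (intro SUP_upper2[of fool]) (auto intro!: ennreal_leI)
    qed
  qed
  then show ?thesis using c by (auto simp: s_def d_def \<iota>_def intro!: exI[of _ c])
qed

end
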